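(* For $q\in\mathbb{C}$ with $|q|<1$, set \begin{align*} P(q)&=\cot \frac{2 \pi}{5} + 4 \sin \frac{4 \pi}{5} \sum_{n=1}^{\infty} (d_{1,5}(n)-d_{4,5}(n)) q^n-4\sin \frac{2\pi}{5} \sum_{n=1}^{\infty} (d_{2,5}(n)-d_{3,5}(n)) q^n, \\ Q(q)&=\cot \frac{ \pi}{5} + 4 \sin \frac{2 \pi}{5} \sum_{n=1}^{\infty} (d_{1,5}(n)-d_{4,5}(n)) q^n+4\sin \frac{4\pi}{5} \sum_{n=1}^{\infty} (d_{2,5}(n)-d_{3,5}(n)) q^n, \\ R(q)&=E_2(q)=1-24\sum_{n=1}^{\infty} \sigma_1(n) q^n. \end{align*} Then \begin{align*} q\frac{d}{dq}P&=\frac{-13P^3-39P^2Q+47PQ^2-9Q^3+2PR}{24}, \\ q\frac{d}{dq}Q&=\frac{9P^3+47P^2Q+39PQ^2-13Q^3+2QR}{24}, \\ q\frac{d}{dq}R&=\frac{5P^4-15P^3Q-155P^2Q^2+15PQ^3+5Q^4+R^2}{12}. \end{align*}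
   Context: For a positive integer $n$, $\sigma_1(n)$ is the sum of the positive divisors of $n$, and $d_{j,5}(n)$ is the number of positive divisors $d$ of $n$ with $d\equiv j \pmod 5$. *)

theory Defs
  imports "HOL-Analysis.Analysis" "HOL-Number_Theory.Cong"
begin

definition sigma1 :: "nat \<Rightarrow> nat" where
  "sigma1 n = (\<Sum>d | d dvd n. d)"

definition dcount5 :: "nat \<Rightarrow> nat \<Rightarrow> nat" where
  "dcount5 j n = card {d. d dvd n \<and> [d = j] (mod 5)}"

definition S14 :: "complex \<Rightarrow> complex" where
  "S14 q = (\<Sum>n. of_int (int (dcount5 1 (Suc n)) - int (dcount5 4 (Suc n))) * q ^ Suc n)"

definition S23 :: "complex \<Rightarrow> complex" where
  "S23 q = (\<Sum>n. of_int (int (dcount5 2 (Suc n)) - int (dcount5 3 (Suc n))) * q ^ Suc n)"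

definition P5 :: "complex \<Rightarrow> complex" where
  "P5 q = of_real (cot (2 * pi / 5)) + 4 * of_real (sin (4 * pi / 5)) * S14 q
            - 4 * of_real (sin (2 * pi / 5)) * S23 q"

definition Q5 :: "complex \<Rightarrow> complex" where
  "Q5 q = of_real (cot (pi / 5)) + 4 * of_real (sin (2 * pi / 5)) * S14 q
            + 4 * of_real (sin (4 * pi / 5)) * S23 q"

definition E2 :: "complex \<Rightarrow> complex" where
  "E2 q = 1 - 24 * (\<Sum>n. of_nat (sigma1 (Suc n)) * q ^ Suc n)"

text \<open>
  Both \<^const>\<open>suminf\<close> and \<^const>\<open>deriv\<close> are total. The lemmas below show that on the open
  unit disc all the series converge and all the functions are differentiable, so that no
  unspecified value is involved there.
\<close>

lemma dcount5_le: "n > 0 \<Longrightarrow> dcount5 j n \<le> n"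
proof -
  assume n: "n > 0"
  have "{d. d dvd n \<and> [d = j] (mod 5)} \<subseteq> {1..n}"
    using n dvd_imp_le[of _ n] dvd_pos_nat[of n] by (auto simp: Suc_le_eq)
  from card_mono[OF _ this] show ?thesis by (simp add: dcount5_def)
qed

lemma sigma1_le: "n > 0 \<Longrightarrow> sigma1 n \<le> n ^ 2"
proof -
  assume n: "n > 0"
  have sub: "{d. d dvd n} \<subseteq> {1..n}"
    using n dvd_imp_le[of _ n] dvd_pos_nat[of n] by (auto simp: Suc_le_eq)
  have "sigma1 n \<le> (\<Sum>d\<in>{1..n}. d)"
    unfolding sigma1_def by (rule sum_mono2) (use sub in auto)
  also have "\<dots> \<le> (\<Sum>d\<in>{1..n}. n)" by (rule sum_mono) auto
  finally show ?thesis by (simp add: power2_eq_square)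
qed

lemma power_series_facts:
  fixes c :: "nat \<Rightarrow> complex" and q :: complex
  assumes c: "\<And>n. norm (c n) \<le> real (Suc n) ^ 2" and q: "norm q < 1"
  shows "summable (\<lambda>n. c n * q ^ Suc n)"
    and "(\<lambda>z. \<Sum>n. c n * z ^ Suc n) field_differentiable at q"
proof -
  have sum: "summable (\<lambda>n. c n * z ^ n)" if z: "norm z < 1" for z
  proof -
    obtain r where r: "norm z < r" "r < 1" using z dense by blast
    have r0: "r > 0" using r(1) norm_ge_zero[of z] by linarith
    have lim: "(\<lambda>n. real (Suc (Suc n)) ^ 2 / real (Suc n) ^ 2) \<longlonglongrightarrow> 1"
    proof -
      have "(\<lambda>n. 1 + inverse (real (Suc n))) \<longlonglongrightarrow> 1 + 0"
        by (intro tendsto_intros LIMSEQ_inverse_real_of_nat)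
      hence "(\<lambda>n. (1 + inverse (real (Suc n))) ^ 2) \<longlonglongrightarrow> (1 + 0) ^ 2"
        by (rule tendsto_power)
      moreover have "(1 + inverse (real (Suc n))) ^ 2 = real (Suc (Suc n)) ^ 2 / real (Suc n) ^ 2" for n
      proof -
        have "1 + inverse (real (Suc n)) = real (Suc (Suc n)) / real (Suc n)"
          by (simp add: divide_simps)
        thus ?thesis by (simp only: power_divide)
      qed
      ultimately show ?thesis by simp
    qed
    have "(\<lambda>n. real (Suc (Suc n)) ^ 2 / real (Suc n) ^ 2 * norm z) \<longlonglongrightarrow> 1 * norm z"
      by (intro tendsto_mult lim tendsto_const)
    hence "eventually (\<lambda>n. real (Suc (Suc n)) ^ 2 / real (Suc n) ^ 2 * norm z < r) sequentially"
      using r(1) by (intro order_tendstoD(2)) auto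
    then obtain N where N: "\<And>n. n \<ge> N \<Longrightarrow> real (Suc (Suc n)) ^ 2 / real (Suc n) ^ 2 * norm z < r"
      by (auto simp: eventually_sequentially)
    have "summable (\<lambda>n. real (Suc n) ^ 2 * norm z ^ n)"
    proof (rule summable_ratio_test[OF r(2)])
      fix n assume "n \<ge> N"
      hence "real (Suc (Suc n)) ^ 2 * norm z \<le> r * real (Suc n) ^ 2"
        using N[of n] by (simp add: divide_simps mult_ac del: of_nat_Suc)
      from mult_right_mono[OF this, of "norm z ^ n"]
      show "norm (real (Suc (Suc n)) ^ 2 * norm z ^ Suc n) \<le> r * norm (real (Suc n) ^ 2 * norm z ^ n)"
        by (simp add: abs_mult mult_ac del: of_nat_Suc)
    qed
    thus ?thesis
      by (rule summable_comparison_test')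
         (auto simp: norm_mult norm_power intro!: mult_right_mono c simp del: of_nat_Suc)
  qed
  show "summable (\<lambda>n. c n * q ^ Suc n)"
    using summable_mult[OF sum[OF q], of q] by (simp add: mult_ac)
  have eq: "(\<Sum>n. c n * z ^ Suc n) = z * (\<Sum>n. c n * z ^ n)" if "norm z < 1" for z
    using suminf_mult[OF sum[OF that], of z] by (simp add: mult_ac)
  have "(\<lambda>z. \<Sum>n. c n * z ^ n) field_differentiable at q"
    using termdiffs_strong'[where K = 1 and z = q and c = c] sum q
    by (auto simp: field_differentiable_def)
  hence "(\<lambda>z. z * (\<Sum>n. c n * z ^ n)) field_differentiable at q"
    by (intro field_differentiable_mult field_differentiable_ident)
  moreover have "(\<Sum>n. c n * z ^ Suc n) = z * (\<Sum>n. c n * z ^ n)"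
    if "dist z q < 1 - norm q" for z
    using that norm_triangle_sub[of z q] by (intro eq) (simp add: dist_norm)
  ultimately show "(\<lambda>z. \<Sum>n. c n * z ^ Suc n) field_differentiable at q"
    using q field_differentiable_transform_within
      [of "1 - norm q" q UNIV "\<lambda>z. z * (\<Sum>n. c n * z ^ n)" "\<lambda>z. \<Sum>n. c n * z ^ Suc n"]
    by (metis UNIV_I diff_gt_0_iff_gt)
qed

lemma norm_dcount5_diff:
  "norm (of_int (int (dcount5 i (Suc n)) - int (dcount5 j (Suc n))) :: complex) \<le> real (Suc n) ^ 2"
proof -
  have "\<bar>int (dcount5 i (Suc n)) - int (dcount5 j (Suc n))\<bar> \<le> int (Suc n)"
    using dcount5_le[of "Suc n" i] dcount5_le[of "Suc n" j] by linarith
  hence "real_of_int \<bar>int (dcount5 i (Suc n)) - int (dcount5 j (Suc n))\<bar> \<le> real (Suc n)"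
    by linarith
  also have "\<dots> \<le> real (Suc n) ^ 2" by (rule self_le_power) auto
  finally show ?thesis by (simp only: norm_of_int of_int_abs)
qed

lemma norm_sigma1: "norm (of_nat (sigma1 (Suc n)) :: complex) \<le> real (Suc n) ^ 2"
proof -
  have "real (sigma1 (Suc n)) \<le> real (Suc n ^ 2)"
    by (subst of_nat_le_iff) (rule sigma1_le, simp)
  thus ?thesis by (simp only: norm_of_nat of_nat_power)
qed

lemma summable_dcount5_diff:
  assumes "norm (q :: complex) < 1"
  shows "summable (\<lambda>n. of_int (int (dcount5 i (Suc n)) - int (dcount5 j (Suc n))) * q ^ Suc n)"
  by (rule power_series_facts(1)[OF norm_dcount5_diff assms])

lemma summable_sigma1:
  assumes "norm (q :: complex) < 1"
  shows "summable (\<lambda>n. of_nat (sigma1 (Suc n)) * q ^ Suc n)"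
  by (rule power_series_facts(1)[OF norm_sigma1 assms])

lemma differentiable_P5_Q5_E2:
  assumes q: "norm q < 1"
  shows "P5 field_differentiable at q" "Q5 field_differentiable at q" "E2 field_differentiable at q"
proof -
  have S: "S14 field_differentiable at q" "S23 field_differentiable at q"
    unfolding S14_def[abs_def] S23_def[abs_def]
    by (rule power_series_facts(2)[OF norm_dcount5_diff q])+
  show "P5 field_differentiable at q" "Q5 field_differentiable at q"
    unfolding P5_def[abs_def] Q5_def[abs_def]
    by (intro field_differentiable_add field_differentiable_diff field_differentiable_mult
              field_differentiable_const S)+
  show "E2 field_differentiable at q"
    unfolding E2_def[abs_def]
    by (intro field_differentiable_diff field_differentiable_mult field_differentiable_const
              power_series_facts(2)[OF norm_sigma1 q])
qed

end

theory Submission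
  imports Defs
begin

text \<open>
  Put \<open>c\<^sub>n = 1 / (1 - q\<^sup>n)\<close> for \<open>n \<noteq> 0\<close> and \<open>c\<^sub>0 = 1/2\<close>. Up to the factor \<open>-2i\<close>, \<open>P\<close> and \<open>Q\<close> are the
  boundary values of the Laurent series \<open>f(x) = \<Sum> c\<^sub>n x\<^sup>n\<close> (over all integers \<open>n\<close>, for \<open>\<bar>q\<bar> < \<bar>x\<bar> < 1\<close>) at
  \<open>z\<^sup>2\<close> and \<open>z\<close>, where \<open>z = exp (2 \<pi> i / 5)\<close>. The identity \<open>c\<^sub>m c\<^sub>n = c\<^bsub>m+n\<^esub> (c\<^sub>m + c\<^sub>n - 1)\<close> gives, by
  comparison of coefficients, with \<open>e(x) = \<Sum> q\<^sup>n / (1 - q\<^sup>n)\<^sup>2 x\<^sup>n\<close> (over \<open>n \<noteq> 0\<close>) and \<open>\<theta> = x d/dx\<close>,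
  the addition formula \<open>f(x) f(y) - f(xy) (f(x) + f(y)) = e(x) + e(y) + e(xy) - 1/4\<close> and
  Ramanujan's identity \<open>f\<^sup>2 = \<theta>f - 2e + (2 + E\<^sub>2)/12\<close>, while \<open>q df/dq = \<theta>e\<close>. The addition formula and its
  images under the powers of \<open>\<theta>\<^sub>x - \<theta>\<^sub>y\<close> (which annihilates functions of \<open>xy\<close>), taken at fifth roots
  of unity, express \<open>\<theta>f\<close>, \<open>\<theta>e\<close> and \<open>\<theta>\<^sup>2e\<close> at \<open>z\<close> and \<open>z\<^sup>2\<close> as polynomials in \<open>P\<close>, \<open>Q\<close> and \<open>E\<^sub>2\<close>. This gives
  the first two equations; the third results from differentiating the expression of \<open>E\<^sub>2\<close> in terms
  of \<open>f\<close> and \<open>\<theta>f\<close>.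
\<close>

section \<open>Summation over the integers and over pairs\<close>

text \<open>Induction on \<open>j\<close>: termwise differentiation followed by multiplication with
  \<open>r\<close> raises the exponent by one and keeps the radius of convergence.\<close>

lemma summable_power_times_geometric:
  fixes r :: real
  assumes "\<bar>r\<bar> < 1"
  shows "summable (\<lambda>n. real n ^ j * r ^ n)"
  using assms
proof (induction j arbitrary: r)
  case 0
  then show ?case by (simp add: summable_geometric)
next
  case (Suc j)
  have "summable (\<lambda>n. diffs (\<lambda>n. real n ^ j) n * r ^ n)"
    using Suc by (intro termdiff_converges[where K = 1]) auto
  then have "summable (\<lambda>n. r * (diffs (\<lambda>n. real n ^ j) n * r ^ n))"
    by (rule summable_mult)
  then have "summable (\<lambda>n. real (Suc n) ^ Suc j * r ^ Suc n)"
    by (simp add: diffs_def mult_ac del: of_nat_Suc)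
  then show ?case
    by (subst (asm) summable_Suc_iff)
qed

text \<open>Both half-line sums contain the index \<open>0\<close>, hence the correction
  \<open>- g 0\<close>.\<close>

lemma has_sum_int_UNIV:
  fixes g :: "int \<Rightarrow> 'a::real_normed_vector"
  assumes pos: "((\<lambda>n. g (int n)) has_sum A) UNIV"
    and neg: "((\<lambda>n. g (- int n)) has_sum B) UNIV"
  shows "(g has_sum (A + B - g 0)) UNIV"
proof -
  have P: "(g has_sum A) {0..}"
  proof -
    have "bij_betw int UNIV {0..}"
      by (rule bij_betwI[where g = nat]) auto
    then show ?thesis
      using pos has_sum_reindex_bij_betw[of int UNIV "{0..}" g A] by simp
  qed
  have N: "(g has_sum B) {..0}"
  proof -
    have "bij_betw (\<lambda>n. - int n) UNIV {..0}"
      by (rule bij_betwI[where g = "\<lambda>z. nat (- z)"]) auto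
    then show ?thesis
      using neg has_sum_reindex_bij_betw[of "\<lambda>n. - int n" UNIV "{..0}" g B] by simp
  qed
  have Z: "(g has_sum g 0) {0}"
    using has_sum_finite[of "{0}" g] by simp
  have "(g has_sum (B - g 0)) ({..0} - {0})"
    by (rule has_sum_Diff[OF N Z]) auto
  from has_sum_Un_disjoint[OF P this]
  have "(g has_sum (A + (B - g 0))) ({0..} \<union> ({..0} - {0}))"
    by (force simp: disjoint_iff)
  moreover have "{0..} \<union> ({..0} - {0}) = (UNIV :: int set)" by auto
  ultimately show ?thesis by (simp add: algebra_simps)
qed

lemma summable_on_int_power_times_geometric:
  fixes r :: real
  assumes "0 \<le> r" "r < 1"
  shows "(\<lambda>n. \<bar>of_int n\<bar> ^ j * r ^ nat \<bar>n\<bar>) summable_on (UNIV :: int set)"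
proof -
  have "summable (\<lambda>n. norm (real n ^ j * r ^ n))"
    using summable_power_times_geometric[of r j] assms by (simp add: abs_mult)
  from norm_summable_imp_has_sum[OF this summable_sums[OF summable_power_times_geometric]]
  have "((\<lambda>n. real n ^ j * r ^ n) has_sum (\<Sum>n. real n ^ j * r ^ n)) UNIV"
    using assms by simp
  then show ?thesis
    using has_sum_int_UNIV[where g = "\<lambda>n. \<bar>of_int n\<bar> ^ j * r ^ nat \<bar>n\<bar>"]
    by (fastforce intro: has_sum_imp_summable)
qed

lemma has_sum_neg:
  fixes f :: "'a \<Rightarrow> complex"
  assumes "(f has_sum a) A"
  shows "((\<lambda>x. - f x) has_sum - a) A"
  using has_sum_cmult_right[OF assms, of "-1"] by simp

lemma has_sum_subtract:
  fixes f g :: "'a \<Rightarrow> complex"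
  assumes "(f has_sum a) A" "(g has_sum b) A"
  shows "((\<lambda>x. f x - g x) has_sum (a - b)) A"
  using has_sum_add[OF assms(1) has_sum_neg[OF assms(2)]] by simp

text \<open>Absolute convergence makes the product summable over pairs, so that products of Laurent
  series can later be regrouped along any bijection of the index pairs.\<close>

lemma has_sum_times:
  fixes f :: "'a \<Rightarrow> complex" and g :: "'b \<Rightarrow> complex"
  assumes "(\<lambda>x. norm (f x)) summable_on A" "(\<lambda>y. norm (g y)) summable_on B"
  assumes f: "(f has_sum a) A" and g: "(g has_sum b) B"
  shows "((\<lambda>(x, y). f x * g y) has_sum (a * b)) (A \<times> B)"
proof (rule has_sum_SigmaI)
  show "((\<lambda>y. case (x, y) of (x, y) \<Rightarrow> f x * g y) has_sum f x * b) B" for x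
    using has_sum_cmult_right[OF g] by simp
  show "((\<lambda>x. f x * b) has_sum a * b) A"
    by (rule has_sum_cmult_left[OF f])
  have "(\<lambda>z. norm (f (fst z) * g (snd z))) summable_on A \<times> B"
  proof (rule summable_on_SigmaI)
    show "((\<lambda>y. norm (f (fst (x, y)) * g (snd (x, y)))) has_sum
            (norm (f x) * infsum (\<lambda>y. norm (g y)) B)) B" for x
      using has_sum_cmult_right[OF has_sum_infsum[OF assms(2)], of "norm (f x)"]
      by (simp add: norm_mult)
    show "(\<lambda>x. norm (f x) * infsum (\<lambda>y. norm (g y)) B) summable_on A"
      by (rule summable_on_cmult_left[OF assms(1)])
  qed auto
  then show "(\<lambda>(x, y). f x * g y) summable_on A \<times> B"
    using abs_summable_summable[of "\<lambda>z. f (fst z) * g (snd z)"] by (simp add: case_prod_unfold)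
qed

section \<open>The coefficients of the Laurent series\<close>

text \<open>At \<open>n = 0\<close> the convention \<open>x / 0 = 0\<close> makes both terms vanish, so that Lambert series may start at \<open>0\<close>.\<close>

definition lam1 :: "complex \<Rightarrow> nat \<Rightarrow> complex" where
  "lam1 q n = q ^ n / (1 - q ^ n)"

definition lam2 :: "complex \<Rightarrow> nat \<Rightarrow> complex" where
  "lam2 q n = q ^ n / (1 - q ^ n) ^ 2"

text \<open>For \<open>q \<noteq> 0\<close> and \<open>n \<noteq> 0\<close> this is \<open>1 / (1 - q\<^sup>n)\<close>; written with nonnegative powers of \<open>q\<close> it covers \<open>q = 0\<close> too.\<close>

definition kcoeff :: "complex \<Rightarrow> int \<Rightarrow> complex" where
  "kcoeff q n = (if n > 0 then 1 + lam1 q (nat n) else if n < 0 then - lam1 q (nat (- n)) else 1 / 2)"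

lemma lam_0 [simp]: "lam1 q 0 = 0" "lam2 q 0 = 0"
  by (simp_all add: lam1_def lam2_def)

lemma one_minus_power_bound:
  fixes q :: complex
  assumes "norm q < 1" "n > 0"
  shows "1 - norm q \<le> norm (1 - q ^ n)"
proof -
  have "norm (q ^ n) \<le> norm q"
    using assms power_decreasing[of 1 n "norm q"] by (simp add: norm_power)
  moreover have "norm (1 :: complex) - norm (q ^ n) \<le> norm (1 - q ^ n)"
    by (rule norm_triangle_ineq2)
  ultimately show ?thesis by simp
qed

lemma one_minus_power_nonzero:
  fixes q :: complex
  assumes "norm q < 1" "n > 0"
  shows "1 - q ^ n \<noteq> 0"
  using one_minus_power_bound[OF assms] assms(1) by (metis diff_gt_0_iff_gt norm_zero not_le)

lemma norm_lam1_le: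
  assumes "norm q < 1"
  shows "norm (lam1 q n) \<le> norm q ^ n / (1 - norm q)"
proof (cases "n = 0")
  case False
  then show ?thesis
    using assms one_minus_power_bound[of q n]
    by (auto simp: lam1_def norm_divide norm_power intro!: divide_left_mono mult_pos_pos)
qed (use assms in auto)

lemma norm_lam2_le:
  assumes "norm q < 1"
  shows "norm (lam2 q n) \<le> norm q ^ n / (1 - norm q) ^ 2"
proof (cases "n = 0")
  case False
  then have "(1 - norm q) ^ 2 \<le> norm (1 - q ^ n) ^ 2"
    using assms by (intro power_mono one_minus_power_bound) auto
  moreover have "(1 - norm q) ^ 2 > 0" using assms by simp
  ultimately show ?thesis
    unfolding lam2_def norm_divide norm_power by (intro divide_left_mono mult_pos_pos) auto
qed (use assms in auto)

lemma kcoeff_0 [simp]: "kcoeff q 0 = 1 / 2"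
  by (simp add: kcoeff_def)

text \<open>The value \<open>1 / 2\<close> at \<open>0\<close> is what makes this reflection valid
  for every integer \<open>n\<close>.\<close>

lemma kcoeff_minus: "kcoeff q (- n) = 1 - kcoeff q n"
  by (auto simp: kcoeff_def)

lemma kcoeff_conv_powi:
  assumes "norm q < 1" "q \<noteq> 0" "n \<noteq> 0"
  shows "q powi n \<noteq> 1" "kcoeff q n = 1 / (1 - q powi n)"
proof -
  consider "n > 0" | "n < 0" using assms(3) by linarith
  then have "q powi n \<noteq> 1 \<and> kcoeff q n = 1 / (1 - q powi n)"
  proof cases
    case 1
    then obtain k where k: "n = int k" "k > 0" by (metis pos_int_cases)
    then show ?thesis using one_minus_power_nonzero[of q k] assms
      by (auto simp: kcoeff_def lam1_def divide_simps)
  next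
    case 2
    then obtain k where k: "n = - int k" "k > 0" by (metis neg_int_cases)
    have "q ^ k \<noteq> 0" using assms by simp
    then show ?thesis using k one_minus_power_nonzero[of q k] assms
      by (auto simp: kcoeff_def lam1_def power_int_minus divide_simps) (simp add: algebra_simps)
  qed
  then show "q powi n \<noteq> 1" "kcoeff q n = 1 / (1 - q powi n)" by auto
qed

text \<open>With \<open>A = q powi m\<close> and \<open>B = q powi n\<close> both sides equal
  \<open>1 / ((1 - A) * (1 - B))\<close>. For \<open>q = 0\<close> the negative powers lose their
  meaning, but there \<open>kcoeff\<close> is just the indicator of the positive integers away from
  \<open>0\<close>.\<close>

lemma kcoeff_mult:
  assumes "norm q < 1" "m \<noteq> 0" "n \<noteq> 0" "m + n \<noteq> 0"
  shows "kcoeff q m * kcoeff q n = kcoeff q (m + n) * (kcoeff q m + kcoeff q n - 1)"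
proof (cases "q = 0")
  case True
  then have "kcoeff q k = (if k > 0 then 1 else 0)" if "k \<noteq> 0" for k
    using that by (auto simp: kcoeff_def lam1_def power_0_left)
  then show ?thesis using assms by auto
next
  case False
  define A B where "A = q powi m" and "B = q powi n"
  have "q powi (m + n) = A * B"
    using False by (simp add: A_def B_def power_int_add)
  then have "A \<noteq> 1" "B \<noteq> 1" "A * B \<noteq> 1"
    and eqs: "kcoeff q m = 1 / (1 - A)" "kcoeff q n = 1 / (1 - B)" "kcoeff q (m + n) = 1 / (1 - A * B)"
    using kcoeff_conv_powi[OF assms(1) False] assms(2-4) by (auto simp: A_def B_def)
  then have nz: "1 - A \<noteq> 0" "1 - B \<noteq> 0" "1 - A * B \<noteq> 0" by auto
  have "1 / (1 - A) + 1 / (1 - B) - 1 = (1 - A * B) / ((1 - A) * (1 - B))"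
    using nz(1,2) by (simp add: divide_simps) (simp add: algebra_simps)
  then show ?thesis unfolding eqs using nz by simp
qed

text \<open>The degenerate case \<open>m + n = 0\<close> of the product rule; it is the source of
  the series \<open>e\<close>.\<close>

lemma kcoeff_mult_minus:
  assumes "norm q < 1" "n \<noteq> 0"
  shows "kcoeff q n * kcoeff q (- n) = - lam2 q (nat \<bar>n\<bar>)"
proof -
  have "(1 + lam1 q k) * lam1 q k = lam2 q k" if "k > 0" for k
    using one_minus_power_nonzero[OF assms(1) that]
    by (simp add: lam1_def lam2_def divide_simps power2_eq_square)
  from this[of "nat \<bar>n\<bar>"] show ?thesis
    using assms(2) by (auto simp: kcoeff_def algebra_simps)
qed

lemma kcoeff_square:
  assumes "norm q < 1" "n \<noteq> 0"
  shows "kcoeff q n * kcoeff q n = kcoeff q n + lam2 q (nat \<bar>n\<bar>)"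
  using kcoeff_mult_minus[OF assms] by (simp add: kcoeff_minus algebra_simps)

text \<open>Away from the lines \<open>r = 0\<close>, \<open>s = 0\<close> and \<open>r = s\<close>,
  the product rule for \<open>s + (r - s) = r\<close> gives zero. Each line contributes a
  \<open>lam2\<close> term; since \<open>lam2 q 0 = 0\<close>, the origin adds only
  \<open>1/4 - 1/4 - 1/4\<close>.\<close>

lemma kcoeff_addition:
  assumes "norm q < 1"
  shows "kcoeff q r * kcoeff q s - kcoeff q s * kcoeff q (r - s) - kcoeff q r * kcoeff q (s - r) =
    (if r = 0 \<and> s = 0 then - 1 / 4 else 0) + (if r = s then lam2 q (nat \<bar>r\<bar>) else 0)
     + (if s = 0 then lam2 q (nat \<bar>r\<bar>) else 0) + (if r = 0 then lam2 q (nat \<bar>s\<bar>) else 0)"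
proof -
  have swap: "kcoeff q (s - r) = 1 - kcoeff q (r - s)"
    using kcoeff_minus[of q "r - s"] by simp
  consider "r = 0" "s = 0" | "r = 0" "s \<noteq> 0" | "r \<noteq> 0" "s = 0" | "r = s" "r \<noteq> 0"
    | "r \<noteq> 0" "s \<noteq> 0" "r \<noteq> s" by blast
  then show ?thesis
  proof cases
    case 2
    then show ?thesis
      using kcoeff_mult_minus[OF assms, of s] by (simp add: algebra_simps)
  next
    case 3
    then show ?thesis
      using kcoeff_mult_minus[OF assms, of r] by (simp add: algebra_simps)
  next
    case 4
    then show ?thesis
      using kcoeff_square[OF assms, of r] by simp
  next
    case 5
    have "kcoeff q s * kcoeff q (r - s) = kcoeff q r * (kcoeff q s + kcoeff q (r - s) - 1)"
      using kcoeff_mult[OF assms, of s "r - s"] 5 by simp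
    then show ?thesis using 5 by (simp add: swap algebra_simps)
  qed simp
qed

section \<open>Telescoping and self-convolution of the coefficients\<close>

lemma has_sum_delta: "((\<lambda>m. if m = a then v else 0) has_sum (v :: 'b :: {comm_monoid_add, topological_space})) UNIV"
proof -
  have "((\<lambda>m. if m = a then v else 0) has_sum v) {a}"
    using has_sum_finite[of "{a}" "\<lambda>m. if m = a then v else 0"] by simp
  then show ?thesis
    by (subst has_sum_cong_neutral[where T = "{a}"]) auto
qed

lemma summable_on_lam_int:
  assumes q: "norm q < 1"
  shows "(\<lambda>m. norm (lam1 q (nat \<bar>m\<bar>))) summable_on (UNIV :: int set)"
    and "(\<lambda>m. norm (lam2 q (nat \<bar>m\<bar>))) summable_on (UNIV :: int set)"
proof -
  have S: "(\<lambda>m::int. norm q ^ nat \<bar>m\<bar> * K) summable_on UNIV" for K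
    using summable_on_int_power_times_geometric[of "norm q" 0] q
    by (intro summable_on_cmult_left) simp
  show "(\<lambda>m. norm (lam1 q (nat \<bar>m\<bar>))) summable_on (UNIV :: int set)"
    by (rule summable_on_comparison_test[OF S[of "1 / (1 - norm q)"]])
       (use norm_lam1_le[OF q] in auto)
  show "(\<lambda>m. norm (lam2 q (nat \<bar>m\<bar>))) summable_on (UNIV :: int set)"
    by (rule summable_on_comparison_test[OF S[of "1 / (1 - norm q) ^ 2"]])
       (use norm_lam2_le[OF q] in auto)
qed

lemma has_sum_shift_int:
  fixes f :: "int \<Rightarrow> 'a::{comm_monoid_add, topological_space}"
  assumes "(f has_sum S) UNIV"
  shows "((\<lambda>m. f (m - k)) has_sum S) UNIV"
  using assms has_sum_reindex_bij_betw[of "\<lambda>m. m - k" UNIV UNIV f S]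
  by (simp add: bij_diff_right)

text \<open>Up to a step function \<open>kcoeff q\<close> is absolutely summable, and only the step contributes.\<close>

lemma kcoeff_telescope_1:
  assumes q: "norm q < 1"
  shows "((\<lambda>m. kcoeff q m - kcoeff q (m - 1)) has_sum 1) UNIV"
proof -
  define h where "h = (\<lambda>m::int. if m > 0 then lam1 q (nat \<bar>m\<bar>) else - lam1 q (nat \<bar>m\<bar>))"
  have "(\<lambda>m. norm (h m)) summable_on UNIV"
    using summable_on_lam_int(1)[OF q] by (rule summable_on_cong[THEN iffD1, rotated]) (auto simp: h_def)
  then have "h summable_on UNIV" by (rule abs_summable_summable)
  then obtain S where S: "(h has_sum S) UNIV" by (auto simp: summable_on_def)
  have "((\<lambda>m. h m - h (m - 1)) has_sum (S - S)) UNIV"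
    by (intro has_sum_subtract S has_sum_shift_int)
  \<comment> \<open>The step function passes from \<open>0\<close> through \<open>1 / 2\<close> at
    \<open>m = 0\<close> to \<open>1\<close>, so its difference is \<open>1 / 2\<close> at both
    \<open>m = 0\<close> and \<open>m = 1\<close>.\<close>
  then have "((\<lambda>m. h m - h (m - 1) + ((if m = 0 then 1 / 2 else 0) + (if m = 1 then 1 / 2 else 0)))
       has_sum (S - S + (1 / 2 + 1 / 2))) UNIV"
    by (intro has_sum_add has_sum_delta)
  moreover have "h m - h (m - 1) + ((if m = 0 then 1 / 2 else 0) + (if m = 1 then 1 / 2 else 0))
      = kcoeff q m - kcoeff q (m - 1)" for m
    by (auto simp: kcoeff_def h_def)
  ultimately show ?thesis by simp
qed

text \<open>A difference over \<open>k\<close> steps is a sum of shifted one-step differences;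
  negative \<open>k\<close> reduces to positive \<open>k\<close> by a shift and a change of
  sign.\<close>

lemma kcoeff_telescope:
  assumes q: "norm q < 1"
  shows "((\<lambda>m. kcoeff q m - kcoeff q (m - k)) has_sum of_int k) UNIV"
proof -
  have pos: "((\<lambda>m. kcoeff q m - kcoeff q (m - int n)) has_sum of_nat n) UNIV" for n
  proof (induction n)
    case (Suc n)
    have "((\<lambda>m. (kcoeff q m - kcoeff q (m - 1)) + (kcoeff q (m - 1) - kcoeff q (m - 1 - int n)))
       has_sum (1 + of_nat n)) UNIV"
      by (intro has_sum_add kcoeff_telescope_1 q has_sum_shift_int[OF Suc])
    then show ?case by (simp add: algebra_simps)
  qed simp
  show ?thesis
  proof (cases "k \<ge> 0")
    case True
    then show ?thesis using pos[of "nat k"] by simp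
  next
    case False
    have "((\<lambda>m. - (kcoeff q (m - k) - kcoeff q (m - k - int (nat (- k))))) has_sum - of_nat (nat (- k))) UNIV"
      by (intro has_sum_neg has_sum_shift_int pos)
    then show ?thesis using False by (simp add: algebra_simps)
  qed
qed

text \<open>These are the coefficients of \<open>f^2\<close>. For \<open>k \<noteq> 0\<close> the
  product rule for \<open>m + (k - m) = k\<close> turns each term into \<open>kcoeff q k\<close>
  times a telescoping difference; only \<open>m = 0\<close> and \<open>m = k\<close> deviate, each
  by \<open>- lam2\<close>. For \<open>k = 0\<close> the terms are \<open>- lam2\<close>, apart from
  \<open>1 / 4\<close> at \<open>m = 0\<close>.\<close>

lemma kcoeff_convolution:
  assumes q: "norm q < 1" and E: "((\<lambda>m::int. lam2 q (nat \<bar>m\<bar>)) has_sum E) UNIV"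
  shows "((\<lambda>m. kcoeff q m * kcoeff q (k - m)) has_sum
     (of_int k * kcoeff q k - 2 * lam2 q (nat \<bar>k\<bar>) + (if k = 0 then 1 / 4 - E else 0))) UNIV"
proof (cases "k = 0")
  case True
  have "((\<lambda>m. - lam2 q (nat \<bar>m\<bar>) + (if m = 0 then 1 / 4 else 0)) has_sum (- E + 1 / 4)) UNIV"
    by (intro has_sum_add has_sum_neg E has_sum_delta)
  moreover have "- lam2 q (nat \<bar>m\<bar>) + (if m = 0 then 1 / 4 else 0) = kcoeff q m * kcoeff q (k - m)" for m
    using True kcoeff_mult_minus[OF q, of m] by auto
  ultimately show ?thesis using True by simp
next
  case False
  let ?e = "lam2 q (nat \<bar>k\<bar>)"
  have "((\<lambda>m. kcoeff q k * (kcoeff q m - kcoeff q (m - k)) +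
          ((if m = 0 then - ?e else 0) + (if m = k then - ?e else 0)))
        has_sum (kcoeff q k * of_int k + (- ?e + - ?e))) UNIV"
    by (intro has_sum_add has_sum_delta has_sum_cmult_right kcoeff_telescope q)
  moreover have "kcoeff q k * (kcoeff q m - kcoeff q (m - k)) +
          ((if m = 0 then - ?e else 0) + (if m = k then - ?e else 0)) = kcoeff q m * kcoeff q (k - m)" for m
  proof -
    consider "m = 0" | "m = k" "m \<noteq> 0" | "m \<noteq> 0" "m \<noteq> k" by blast
    then show ?thesis
    proof cases
      case 1
      then show ?thesis using False kcoeff_mult_minus[OF q False]
        by (simp add: algebra_simps)
    next
      case 2
      then show ?thesis using False kcoeff_square[OF q False] by (simp add: algebra_simps)
    next
      case 3
      have "kcoeff q (m - k) = 1 - kcoeff q (k - m)"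
        using kcoeff_minus[of q "k - m"] by simp
      then show ?thesis using 3 False kcoeff_mult[OF q, of m "k - m"] by simp
    qed
  qed
  ultimately show ?thesis using False by (simp add: algebra_simps)
qed

section \<open>The Laurent series and their addition formula\<close>

text \<open>\<open>kser j\<close> and \<open>eser j\<close> are the images of \<open>f\<close> and \<open>e\<close> under \<open>\<theta>\<^sup>j\<close>.\<close>

definition kser :: "nat \<Rightarrow> complex \<Rightarrow> complex \<Rightarrow> complex" where
  "kser j q x = (\<Sum>\<^sub>\<infinity>n::int. of_int n ^ j * kcoeff q n * x powi n)"

definition eser :: "nat \<Rightarrow> complex \<Rightarrow> complex \<Rightarrow> complex" where
  "eser j q x = (\<Sum>\<^sub>\<infinity>n::int. of_int n ^ j * lam2 q (nat \<bar>n\<bar>) * x powi n)"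

lemma summable_on_laurent:
  fixes b :: "int \<Rightarrow> complex"
  assumes r: "r < 1" and R: "0 \<le> R" "R < 1"
    and x: "x \<noteq> 0"
    and pos: "\<And>n. norm (b (int n)) * norm x ^ n \<le> K * R ^ n"
    and neg: "\<And>n. norm (b (- int n)) * (1 / norm x) ^ n \<le> K * R ^ n"
  shows "(\<lambda>n. norm (of_int n ^ j * b n * x powi n)) summable_on UNIV"
proof -
  have S: "(\<lambda>n::int. K * (\<bar>of_int n\<bar> ^ j * R ^ nat \<bar>n\<bar>)) summable_on UNIV"
    by (intro summable_on_cmult_right summable_on_int_power_times_geometric R)
  have le: "norm (b n * x powi n) \<le> K * R ^ nat \<bar>n\<bar>" for n
  proof (cases "n \<ge> 0")
    case True
    then show ?thesis using pos[of "nat n"]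
      by (simp add: norm_mult norm_power_int) (simp add: power_int_def)
  next
    case False
    then show ?thesis using neg[of "nat (- n)"]
      by (simp add: norm_mult norm_power_int) (simp add: power_int_def inverse_eq_divide)
  qed
  show ?thesis
  proof (rule summable_on_comparison_test[OF S])
    fix n :: int
    show "norm (of_int n ^ j * b n * x powi n) \<le> K * (\<bar>of_int n\<bar> ^ j * R ^ nat \<bar>n\<bar>)"
      using mult_left_mono[OF le[of n], of "\<bar>of_int n\<bar> ^ j"]
      by (simp add: norm_mult norm_power mult_ac)
  qed auto
qed

section \<open>Absolute convergence of the Laurent series on annuli\<close>

lemma norm_kcoeff_le:
  assumes q: "norm q < 1"
  shows "norm (kcoeff q n) \<le> 1 + 1 / (1 - norm q)"
proof -
  have l: "norm (lam1 q k) \<le> 1 / (1 - norm q)" for k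
  proof -
    have "norm q ^ k / (1 - norm q) \<le> 1 / (1 - norm q)"
      using q by (intro divide_right_mono) (auto simp: power_le_one)
    with norm_lam1_le[OF q, of k] show ?thesis by linarith
  qed
  have "norm (1 + lam1 q k) \<le> 1 + 1 / (1 - norm q)" for k
    using norm_triangle_ineq[of 1 "lam1 q k"] l[of k] by (simp only: norm_one)
  moreover have "norm (- lam1 q k) \<le> 1 + 1 / (1 - norm q)" for k
    using l[of k] by simp
  moreover have "0 \<le> 1 / (1 - norm q)" using q by simp
  then have "norm (1 / 2 :: complex) \<le> 1 + 1 / (1 - norm q)"
    by (simp only: norm_divide norm_one norm_numeral)
  ultimately show ?thesis
    by (simp only: kcoeff_def split: if_split) blast
qed

text \<open>The coefficients are bounded for positive indices and decay like
  \<open>norm q ^ n\<close> at \<open>- n\<close>, which gives the annulus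
  \<open>norm q < norm x < 1\<close>.\<close>

lemma summable_on_kser:
  assumes q: "norm q < norm x" "norm x < 1"
  shows "(\<lambda>n. norm (of_int n ^ j * kcoeff q n * x powi n)) summable_on UNIV"
proof -
  define R where "R = max (norm x) (norm q / norm x)"
  have q1: "norm q < 1" using q by linarith
  have x0: "norm x > 0" using q(1) norm_ge_zero[of q] by linarith
  have R: "0 \<le> R" "R < 1" using q x0 by (auto simp: R_def le_max_iff_disj)
  let ?K = "1 + 1 / (1 - norm q)"
  have K: "?K \<ge> 0" using q1 by simp
  show ?thesis
  proof (rule summable_on_laurent[OF q(2) R])
    show "x \<noteq> 0" using x0 by auto
    fix n
    show "norm (kcoeff q (int n)) * norm x ^ n \<le> ?K * R ^ n"
      by (intro mult_mono norm_kcoeff_le[OF q1] power_mono K) (auto simp: R_def)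
    show "norm (kcoeff q (- int n)) * (1 / norm x) ^ n \<le> ?K * R ^ n"
    proof -
      have "norm (kcoeff q (- int n)) \<le> ?K * norm q ^ n"
      proof (cases "n = 0")
        case True
        then show ?thesis using norm_kcoeff_le[OF q1, of 0] by simp
      next
        case False
        have "norm (kcoeff q (- int n)) \<le> norm q ^ n / (1 - norm q)"
          using False norm_lam1_le[OF q1] by (simp add: kcoeff_def)
        also have "\<dots> \<le> ?K * norm q ^ n" by (simp add: algebra_simps)
        finally show ?thesis .
      qed
      then have "norm (kcoeff q (- int n)) * (1 / norm x) ^ n \<le> ?K * norm q ^ n * (1 / norm x) ^ n"
        by (intro mult_right_mono) auto
      also have "\<dots> = ?K * (norm q / norm x) ^ n"
        by (simp add: power_divide)
      also have "\<dots> \<le> ?K * R ^ n"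
        by (intro mult_left_mono power_mono K) (auto simp: R_def)
      finally show ?thesis .
    qed
  qed
qed

text \<open>Here the coefficients decay like a power of \<open>norm q\<close> in both directions, so
  the annulus contains the unit circle. Thus \<open>eser\<close> can be evaluated there directly,
  whereas \<open>kser\<close> needs a limit.\<close>

lemma summable_on_eser:
  assumes q: "norm q < 1" "norm q < norm x" "norm q * norm x < 1"
  shows "(\<lambda>n. norm (of_int n ^ j * lam2 q (nat \<bar>n\<bar>) * x powi n)) summable_on UNIV"
proof -
  define R where "R = max (norm q * norm x) (norm q / norm x)"
  have x0: "norm x > 0" using q(2) norm_ge_zero[of q] by linarith
  have R: "0 \<le> R" "R < 1" using q x0 by (auto simp: R_def le_max_iff_disj)
  let ?K = "1 / (1 - norm q) ^ 2"
  have K: "?K \<ge> 0" by simp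
  have e: "norm (lam2 q n) \<le> ?K * norm q ^ n" for n
    using norm_lam2_le[OF q(1), of n] by simp
  show ?thesis
  proof (rule summable_on_laurent[where K = ?K, OF q(1) R])
    show "x \<noteq> 0" using x0 by auto
    fix n
    have "norm (lam2 q n) * norm x ^ n \<le> ?K * norm q ^ n * norm x ^ n"
      by (intro mult_right_mono e) auto
    also have "\<dots> = ?K * (norm q * norm x) ^ n" by (simp add: power_mult_distrib)
    also have "\<dots> \<le> ?K * R ^ n"
      by (intro mult_left_mono power_mono K) (auto simp: R_def)
    finally show "norm (lam2 q (nat \<bar>int n\<bar>)) * norm x ^ n \<le> ?K * R ^ n" by simp
    have "norm (lam2 q n) * (1 / norm x) ^ n \<le> ?K * norm q ^ n * (1 / norm x) ^ n"
      by (intro mult_right_mono e) auto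
    also have "\<dots> = ?K * (norm q / norm x) ^ n" by (simp add: power_divide)
    also have "\<dots> \<le> ?K * R ^ n"
      by (intro mult_left_mono power_mono K) (auto simp: R_def)
    finally show "norm (lam2 q (nat \<bar>- int n\<bar>)) * (1 / norm x) ^ n \<le> ?K * R ^ n" by simp
  qed
qed

lemma has_sum_kser:
  assumes "norm q < norm x" "norm x < 1"
  shows "((\<lambda>n. of_int n ^ j * kcoeff q n * x powi n) has_sum kser j q x) UNIV"
  unfolding kser_def by (rule has_sum_infsum[OF abs_summable_summable[OF summable_on_kser[OF assms]]])

lemma has_sum_eser:
  assumes "norm q < 1" "norm q < norm x" "norm q * norm x < 1"
  shows "((\<lambda>n. of_int n ^ j * lam2 q (nat \<bar>n\<bar>) * x powi n) has_sum eser j q x) UNIV"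
  unfolding eser_def by (rule has_sum_infsum[OF abs_summable_summable[OF summable_on_eser[OF assms]]])

lemma has_sum_kser_times:
  assumes "norm q < norm x" "norm x < 1" "norm q < norm y" "norm y < 1"
  shows "((\<lambda>(m, n). of_int m ^ i * of_int n ^ j * (kcoeff q m * kcoeff q n) * (x powi m * y powi n))
           has_sum (kser i q x * kser j q y)) UNIV"
proof -
  note * = has_sum_times[OF summable_on_kser[OF assms(1,2), of i] summable_on_kser[OF assms(3,4), of j]
      has_sum_kser[OF assms(1,2), of i] has_sum_kser[OF assms(3,4), of j]]
  have "(\<lambda>(m, n). of_int m ^ i * of_int n ^ j * (kcoeff q m * kcoeff q n) * (x powi m * y powi n)) =
    (\<lambda>(m, n). (of_int m ^ i * kcoeff q m * x powi m) * (of_int n ^ j * kcoeff q n * y powi n))"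
    by (simp add: fun_eq_iff mult_ac)
  then show ?thesis using * by simp
qed

text \<open>Used to view a single series as a double series supported on a line in the index
  plane.\<close>

lemma has_sum_inj_support:
  fixes F :: "'b \<Rightarrow> 'c :: {comm_monoid_add, topological_space}"
  assumes "(g has_sum S) UNIV" "inj h" "\<And>n. F (h n) = g n" "\<And>z. z \<notin> range h \<Longrightarrow> F z = 0"
  shows "(F has_sum S) UNIV"
proof -
  have "(F has_sum S) (range h)"
    using assms by (subst has_sum_reindex) (auto simp: o_def)
  then show ?thesis
    by (subst has_sum_cong_neutral[where T = "range h"]) (use assms in auto)
qed

text \<open>The sum \<open>S\<close> is the image of \<open>f(x) f(y)\<close> under \<open>(\<theta>\<^sub>x - \<theta>\<^sub>y)\<^sup>j\<close>; the coefficient of \<open>x\<^sup>r y\<^sup>s\<close> in the whole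
  left-hand side is given by kcoeff_addition.\<close>

lemma kser_addition_aux:
  assumes x: "norm q < norm x" "norm x < 1" and y: "norm q < norm y" "norm y < 1"
    and xy: "norm q < norm (x * y)"
    and S: "((\<lambda>(r, s). of_int (r - s) ^ j * (kcoeff q r * kcoeff q s) * (x powi r * y powi s)) has_sum S) UNIV"
  shows "S - kser 0 q (x * y) * (kser j q x + (-1) ^ j * kser j q y)
    = 0 ^ j * (- 1 / 4 + eser 0 q (x * y)) + eser j q x + (-1) ^ j * eser j q y"
proof -
  define c where "c = kcoeff q"
  define e where "e = (\<lambda>n::int. lam2 q (nat \<bar>n\<bar>))"
  have q1: "norm q < 1" using x by linarith
  have nz: "x \<noteq> 0" "y \<noteq> 0" using x y norm_ge_zero[of q] by auto
  have xy1: "norm (x * y) < 1"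
    using mult_strict_mono'[of "norm x" 1 "norm y" 1] x y by (simp add: norm_mult)
  have prods: "norm q * norm z < 1" if "norm z < 1" for z
    using mult_strict_mono'[of "norm q" 1 "norm z" 1] q1 that by simp
  have X: "((\<lambda>(r, s). of_int (r - s) ^ j * (c s * c (r - s)) * (x powi r * y powi s))
      has_sum (kser 0 q (x * y) * kser j q x)) UNIV"
  proof -
    \<comment> \<open>The monomial \<open>x powi r * y powi s\<close> is
      \<open>(x * y) powi s * x powi (r - s)\<close>, so this reindexing exhibits the coefficients
      of \<open>f(xy) f(x)\<close> with respect to \<open>x\<close> and \<open>y\<close>.\<close>
    have "bij (\<lambda>(r, s). (s, r - s) :: int \<times> int)"
      by (rule o_bij[where g = "\<lambda>(m, n). (m + n, m)"]) auto
    from has_sum_reindex_bij_betw[OF this, THEN iffD2, OF has_sum_kser_times[OF xy xy1 x, of 0 j]]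
    have "((\<lambda>z. case z of (r, s) \<Rightarrow> of_int (r - s) ^ j * (c s * c (r - s)) * ((x * y) powi s * x powi (r - s)))
      has_sum (kser 0 q (x * y) * kser j q x)) UNIV"
      by (simp add: case_prod_unfold c_def)
    moreover have "(x * y) powi s * x powi (r - s) = x powi r * y powi s" for r s
      using nz power_int_add[of x s "r - s"] by (simp add: power_int_mult_distrib)
    ultimately show ?thesis by simp
  qed
  have Y: "((\<lambda>(r, s). of_int (s - r) ^ j * (c r * c (s - r)) * (x powi r * y powi s))
      has_sum (kser 0 q (x * y) * kser j q y)) UNIV"
  proof -
    have "bij (\<lambda>(r, s). (r, s - r) :: int \<times> int)"
      by (rule o_bij[where g = "\<lambda>(m, n). (m, m + n)"]) auto
    from has_sum_reindex_bij_betw[OF this, THEN iffD2, OF has_sum_kser_times[OF xy xy1 y, of 0 j]]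
    have "((\<lambda>z. case z of (r, s) \<Rightarrow> of_int (s - r) ^ j * (c r * c (s - r)) * ((x * y) powi r * y powi (s - r)))
      has_sum (kser 0 q (x * y) * kser j q y)) UNIV"
      by (simp add: case_prod_unfold c_def)
    moreover have "(x * y) powi r * y powi (s - r) = x powi r * y powi s" for r s
      using nz power_int_add[of y r "s - r"] by (simp add: power_int_mult_distrib)
    ultimately show ?thesis by simp
  qed
  define T where "T = (\<lambda>(r, s). of_int (r - s) ^ j *
     (c r * c s - c s * c (r - s) - c r * c (s - r)) * (x powi r * y powi s))"
  have "(T has_sum (S - kser 0 q (x * y) * kser j q x - (-1) ^ j * (kser 0 q (x * y) * kser j q y))) UNIV"
  proof -
    have "((\<lambda>z. (case z of (r, s) \<Rightarrow> of_int (r - s) ^ j * (kcoeff q r * kcoeff q s) * (x powi r * y powi s))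
        - (case z of (r, s) \<Rightarrow> of_int (r - s) ^ j * (c s * c (r - s)) * (x powi r * y powi s))
        - (-1) ^ j * (case z of (r, s) \<Rightarrow> of_int (s - r) ^ j * (c r * c (s - r)) * (x powi r * y powi s)))
      has_sum (S - kser 0 q (x * y) * kser j q x - (-1) ^ j * (kser 0 q (x * y) * kser j q y))) UNIV"
      by (intro has_sum_subtract has_sum_cmult_right X Y S)
    moreover have "(case z of (r, s) \<Rightarrow> of_int (r - s) ^ j * (kcoeff q r * kcoeff q s) * (x powi r * y powi s))
        - (case z of (r, s) \<Rightarrow> of_int (r - s) ^ j * (c s * c (r - s)) * (x powi r * y powi s))
        - (-1) ^ j * (case z of (r, s) \<Rightarrow> of_int (s - r) ^ j * (c r * c (s - r)) * (x powi r * y powi s)) = T z" for z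
    proof (cases z)
      case (Pair r s)
      have "(of_int (r - s) :: complex) ^ j = (-1) ^ j * of_int (s - r) ^ j"
        by (simp flip: power_mult_distrib)
      then have "(-1) ^ j * (of_int (s - r) ^ j * (c r * c (s - r)) * (x powi r * y powi s))
          = of_int (r - s) ^ j * (c r * c (s - r)) * (x powi r * y powi s)"
        by (simp only: mult.assoc)
      then show ?thesis
        by (simp only: Pair T_def prod.case left_diff_distrib right_diff_distrib c_def)
    qed
    ultimately show ?thesis by (simp only:)
  qed
  moreover have "(T has_sum (0 ^ j * (- 1 / 4) + 0 ^ j * eser 0 q (x * y) + eser j q x + (-1) ^ j * eser j q y)) UNIV"
  proof -
    \<comment> \<open>The coefficients are split by support: the origin, the diagonal and the two
      axes. On the diagonal and at the origin the factor \<open>of_int (r - s) ^ j\<close> becomes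
      \<open>0 ^ j\<close>, so these parts survive only for \<open>j = 0\<close>.\<close>
    define Tz where "Tz = (\<lambda>z :: int \<times> int. if z = (0, 0) then 0 ^ j * (- 1 / 4) else 0 :: complex)"
    define Td where "Td = (\<lambda>(r, s). if r = s then 0 ^ j * (e r * (x * y) powi r) else 0 :: complex)"
    define Tx where "Tx = (\<lambda>(r, s :: int). if s = 0 then of_int r ^ j * e r * x powi r else 0 :: complex)"
    define Ty where "Ty = (\<lambda>(r :: int, s). if r = 0 then (-1) ^ j * (of_int s ^ j * e s * y powi s) else 0 :: complex)"
    have "(Tz has_sum 0 ^ j * (- 1 / 4)) UNIV"
      unfolding Tz_def by (rule has_sum_delta)
    moreover have "(Td has_sum 0 ^ j * eser 0 q (x * y)) UNIV"
      by (rule has_sum_inj_support[where h = "\<lambda>r. (r, r)", OF has_sum_cmult_right[OF has_sum_eser]])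
         (use q1 xy prods[OF xy1] in \<open>auto simp: Td_def e_def inj_def norm_mult\<close>)
    moreover have "(Tx has_sum eser j q x) UNIV"
      by (rule has_sum_inj_support[where h = "\<lambda>r. (r, 0)", OF has_sum_eser])
         (use q1 x prods[OF x(2)] in \<open>auto simp: Tx_def e_def inj_def\<close>)
    moreover have "(Ty has_sum (-1) ^ j * eser j q y) UNIV"
      by (rule has_sum_inj_support[where h = "\<lambda>r. (0, r)", OF has_sum_cmult_right[OF has_sum_eser]])
         (use q1 y prods[OF y(2)] in \<open>auto simp: Ty_def e_def inj_def\<close>)
    ultimately have "((\<lambda>z. Tz z + Td z + Tx z + Ty z) has_sum
        (0 ^ j * (- 1 / 4) + 0 ^ j * eser 0 q (x * y) + eser j q x + (-1) ^ j * eser j q y)) UNIV"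
      by (intro has_sum_add)
    moreover have "Tz z + Td z + Tx z + Ty z = T z" for z
    proof (cases z)
      case (Pair r s)
      have "(- of_int s :: complex) ^ j = (-1) ^ j * of_int s ^ j"
        by (rule power_minus)
      then show ?thesis
        unfolding T_def Pair c_def using kcoeff_addition[OF q1, of r s] nz
        by (auto simp: Tz_def Td_def Tx_def Ty_def e_def power_int_mult_distrib)
    qed
    ultimately show ?thesis by simp
  qed
  ultimately show ?thesis
    by (auto dest: has_sum_unique simp: algebra_simps)
qed

text \<open>The cases \<open>j = 0, 1, 2\<close>, with \<open>(r - s) ^ j\<close> expanded by the
  binomial theorem into products of \<open>kser\<close> values.\<close>

lemma kser_addition:
  assumes x: "norm q < norm x" "norm x < 1" and y: "norm q < norm y" "norm y < 1"
    and xy: "norm q < norm (x * y)"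
  shows "kser 0 q x * kser 0 q y - kser 0 q (x * y) * (kser 0 q x + kser 0 q y)
           = - 1 / 4 + eser 0 q (x * y) + eser 0 q x + eser 0 q y" (is ?th0)
    and "kser 1 q x * kser 0 q y - kser 0 q x * kser 1 q y - kser 0 q (x * y) * (kser 1 q x - kser 1 q y)
           = eser 1 q x - eser 1 q y" (is ?th1)
    and "kser 2 q x * kser 0 q y - 2 * kser 1 q x * kser 1 q y + kser 0 q x * kser 2 q y
             - kser 0 q (x * y) * (kser 2 q x + kser 2 q y)
           = eser 2 q x + eser 2 q y" (is ?th2)
proof -
  note P = has_sum_kser_times[OF x y]
  note aux = kser_addition_aux[OF x y xy]
  have "((\<lambda>(r, s). of_int (r - s) ^ 0 * (kcoeff q r * kcoeff q s) * (x powi r * y powi s))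
    has_sum (kser 0 q x * kser 0 q y)) UNIV"
    using P[of 0 0] by simp
  from aux[OF this] show ?th0 by simp
  have "((\<lambda>(r, s). of_int (r - s) ^ 1 * (kcoeff q r * kcoeff q s) * (x powi r * y powi s))
    has_sum (kser 1 q x * kser 0 q y - kser 0 q x * kser 1 q y)) UNIV"
    using has_sum_subtract[OF P[of 1 0] P[of 0 1]]
    by (simp add: case_prod_unfold algebra_simps)
  from aux[OF this] show ?th1 by simp
  have "((\<lambda>(r, s). of_int (r - s) ^ 2 * (kcoeff q r * kcoeff q s) * (x powi r * y powi s))
    has_sum (kser 2 q x * kser 0 q y - 2 * (kser 1 q x * kser 1 q y) + kser 0 q x * kser 2 q y)) UNIV"
    using has_sum_add[OF has_sum_subtract[OF P[of 2 0] has_sum_cmult_right[OF P[of 1 1], of 2]] P[of 0 2]]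
    by (simp add: case_prod_unfold power2_eq_square algebra_simps)
  from aux[OF this] show ?th2 by (simp add: algebra_simps)
qed

text \<open>The double series is summed along the fibres \<open>m + n = k\<close>, where
  \<open>kcoeff_convolution\<close> evaluates the inner sum. Its factor
  \<open>k * kcoeff q k\<close> raises the order of \<open>kser\<close> by one; the constant at
  \<open>k = 0\<close> remains only for \<open>j = 0\<close>.\<close>

lemma kser_square_aux:
  assumes x: "norm q < norm x" "norm x < 1"
    and S: "((\<lambda>(m, n). of_int (m + n) ^ j * (kcoeff q m * kcoeff q n) * (x powi m * x powi n)) has_sum S) UNIV"
  shows "S = kser (Suc j) q x - 2 * eser j q x + 0 ^ j * (1 / 4 - eser 0 q 1)"
proof -
  have q1: "norm q < 1" using x by linarith
  have nz: "x \<noteq> 0" using x norm_ge_zero[of q] by auto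
  have qx: "norm q * norm x < 1"
    using mult_strict_mono'[of "norm q" 1 "norm x" 1] q1 x by simp
  have E: "((\<lambda>m::int. lam2 q (nat \<bar>m\<bar>)) has_sum eser 0 q 1) UNIV"
    using has_sum_eser[of q 1 0] q1 by simp
  have "bij (\<lambda>(k, m). (m, k - m) :: int \<times> int)"
    by (rule o_bij[where g = "\<lambda>(m, n). (m + n, m)"]) auto
  from has_sum_reindex_bij_betw[OF this, THEN iffD2, OF S]
  have "((\<lambda>(k, m). of_int k ^ j * (kcoeff q m * kcoeff q (k - m)) * (x powi m * x powi (k - m))) has_sum S) UNIV"
    by (simp add: case_prod_unfold)
  moreover have "x powi m * x powi (k - m) = x powi k" for k m
    using nz power_int_add[of x m "k - m"] by simp
  ultimately have "((\<lambda>(k, m). of_int k ^ j * x powi k * (kcoeff q m * kcoeff q (k - m))) has_sum S) (UNIV \<times> UNIV)"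
    by (simp add: mult_ac)
  then have "((\<lambda>k. of_int k ^ j * x powi k * (of_int k * kcoeff q k - 2 * lam2 q (nat \<bar>k\<bar>)
       + (if k = 0 then 1 / 4 - eser 0 q 1 else 0))) has_sum S) UNIV"
    by (rule has_sum_SigmaD)
       (use has_sum_cmult_right[OF kcoeff_convolution[OF q1 E]] in simp)
  moreover have "((\<lambda>k. of_int k ^ Suc j * kcoeff q k * x powi k
        - 2 * (of_int k ^ j * lam2 q (nat \<bar>k\<bar>) * x powi k)
        + (if k = 0 then 0 ^ j * (1 / 4 - eser 0 q 1) else 0))
      has_sum (kser (Suc j) q x - 2 * eser j q x + 0 ^ j * (1 / 4 - eser 0 q 1))) UNIV"
    by (intro has_sum_add has_sum_subtract has_sum_cmult_right has_sum_kser has_sum_eser has_sum_delta x q1 qx)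
  moreover have "of_int k ^ j * x powi k * (of_int k * kcoeff q k - 2 * lam2 q (nat \<bar>k\<bar>)
       + (if k = 0 then 1 / 4 - eser 0 q 1 else 0)) =
      of_int k ^ Suc j * kcoeff q k * x powi k - 2 * (of_int k ^ j * lam2 q (nat \<bar>k\<bar>) * x powi k)
        + (if k = 0 then 0 ^ j * (1 / 4 - eser 0 q 1) else 0)" for k
    by (cases "k = 0") (simp_all add: algebra_simps)
  ultimately show ?thesis by (auto dest: has_sum_unique)
qed

text \<open>Ramanujan's identity and its image under \<open>\<theta>\<close>. By
  \<open>E2 q = 1 - 12 * eser 0 q 1\<close> the constant is \<open>(2 + E2 q) / 12\<close>.\<close>

lemma kser_square:
  assumes x: "norm q < norm x" "norm x < 1"
  shows "kser 0 q x ^ 2 = kser 1 q x - 2 * eser 0 q x + (1 / 4 - eser 0 q 1)" (is ?th0)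
    and "2 * kser 0 q x * kser 1 q x = kser 2 q x - 2 * eser 1 q x" (is ?th1)
proof -
  note P = has_sum_kser_times[OF x x]
  have "((\<lambda>(m, n). of_int (m + n) ^ 0 * (kcoeff q m * kcoeff q n) * (x powi m * x powi n))
    has_sum kser 0 q x ^ 2) UNIV"
    using P[of 0 0] by (simp add: power2_eq_square)
  from kser_square_aux[OF x this] show ?th0 by simp
  have "((\<lambda>(m, n). of_int (m + n) ^ 1 * (kcoeff q m * kcoeff q n) * (x powi m * x powi n))
    has_sum (2 * kser 0 q x * kser 1 q x)) UNIV"
    using has_sum_add[OF P[of 0 1] P[of 1 0]] by (simp add: case_prod_unfold algebra_simps)
  from kser_square_aux[OF x this] show ?th1 by (simp add: numeral_2_eq_2)
qed

section \<open>Boundary values on the unit circle\<close>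

lemma summable_power_times_powser:
  fixes a :: "nat \<Rightarrow> complex"
  assumes a: "\<And>n. norm (a n) \<le> K * norm q ^ n" and qx: "norm q * norm x < 1"
  shows "summable (\<lambda>n. norm (of_nat n ^ j * a n * x ^ n))"
proof (rule summable_comparison_test')
  show "summable (\<lambda>n. K * (real n ^ j * (norm q * norm x) ^ n))"
    using qx by (intro summable_mult summable_power_times_geometric) (simp add: abs_mult)
  fix n
  have "real n ^ j * (norm (a n) * norm x ^ n) \<le> real n ^ j * ((K * norm q ^ n) * norm x ^ n)"
    by (intro mult_left_mono mult_right_mono a) auto
  then show "norm (norm (of_nat n ^ j * a n * x ^ n)) \<le> K * (real n ^ j * (norm q * norm x) ^ n)"
    by (simp add: norm_mult norm_power power_mult_distrib mult_ac)
qed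

lemma isCont_power_times_powser:
  fixes a :: "nat \<Rightarrow> complex"
  assumes a: "\<And>n. norm (a n) \<le> K * norm q ^ n" and qx: "norm q * norm x < 1"
  shows "isCont (\<lambda>x. \<Sum>n. of_nat n ^ j * a n * x ^ n) x"
proof -
  obtain R where R: "norm x < R" "norm q * R < 1"
  proof (cases "q = 0")
    case True
    then show ?thesis using that[of "norm x + 1"] by simp
  next
    case False
    then have "norm x < 1 / norm q" using qx by (simp add: field_simps)
    then obtain R where "norm x < R" "R < 1 / norm q" using dense by blast
    then show ?thesis using that[of R] False by (simp add: field_simps)
  qed
  then have "R > 0" using norm_ge_zero[of x] by linarith
  have "summable (\<lambda>n. of_nat n ^ j * a n * of_real R ^ n)"
    by (rule summable_norm_cancel, rule summable_power_times_powser[where K = K and q = q])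
       (use a R \<open>R > 0\<close> in auto)
  then show ?thesis
    using isCont_powser[of "\<lambda>n. of_nat n ^ j * a n" "of_real R" x] R \<open>R > 0\<close> by simp
qed

section \<open>Lambert series and the continuation of \<open>f\<close> to the unit circle\<close>

definition lam1_ser :: "nat \<Rightarrow> complex \<Rightarrow> complex \<Rightarrow> complex" where
  "lam1_ser j q x = (\<Sum>n. of_nat n ^ j * lam1 q n * x ^ n)"

definition lam2_ser :: "nat \<Rightarrow> complex \<Rightarrow> complex \<Rightarrow> complex" where
  "lam2_ser j q x = (\<Sum>n. of_nat n ^ j * lam2 q n * x ^ n)"

lemma norm_lam1_le': "norm q < 1 \<Longrightarrow> norm (lam1 q n) \<le> 1 / (1 - norm q) * norm q ^ n"
  using norm_lam1_le by simp

lemma norm_lam2_le': "norm q < 1 \<Longrightarrow> norm (lam2 q n) \<le> 1 / (1 - norm q) ^ 2 * norm q ^ n"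
  using norm_lam2_le by simp

lemma has_sum_lam_ser:
  assumes "norm q < 1" "norm q * norm x < 1"
  shows "((\<lambda>n. of_nat n ^ j * lam1 q n * x ^ n) has_sum lam1_ser j q x) UNIV"
    and "((\<lambda>n. of_nat n ^ j * lam2 q n * x ^ n) has_sum lam2_ser j q x) UNIV"
proof -
  show "((\<lambda>n. of_nat n ^ j * lam1 q n * x ^ n) has_sum lam1_ser j q x) UNIV"
    using summable_power_times_powser[OF norm_lam1_le'[OF assms(1)] assms(2), of j]
    unfolding lam1_ser_def
    by (intro norm_summable_imp_has_sum summable_sums) (auto dest: summable_norm_cancel)
  show "((\<lambda>n. of_nat n ^ j * lam2 q n * x ^ n) has_sum lam2_ser j q x) UNIV"
    using summable_power_times_powser[OF norm_lam2_le'[OF assms(1)] assms(2), of j]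
    unfolding lam2_ser_def
    by (intro norm_summable_imp_has_sum summable_sums) (auto dest: summable_norm_cancel)
qed

lemma isCont_lam_ser:
  assumes "norm q < 1" "norm q * norm x < 1"
  shows "isCont (lam1_ser j q) x" "isCont (lam2_ser j q) x"
  unfolding lam1_ser_def lam2_ser_def
  by (rule isCont_power_times_powser[OF norm_lam1_le'[OF assms(1)] assms(2)]
           isCont_power_times_powser[OF norm_lam2_le'[OF assms(1)] assms(2)])+

lemma eser_eq:
  assumes "norm q < 1" "norm q < norm x" "norm q * norm x < 1"
  shows "eser j q x = lam2_ser j q x + (-1) ^ j * lam2_ser j q (1 / x)"
proof -
  have x0: "x \<noteq> 0" using assms norm_ge_zero[of q] by auto
  have inv: "norm q * norm (1 / x) < 1"
    using assms x0 by (simp add: norm_divide divide_simps)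
  define g where "g = (\<lambda>n::int. of_int n ^ j * lam2 q (nat \<bar>n\<bar>) * x powi n)"
  have "((\<lambda>n. g (int n)) has_sum lam2_ser j q x) UNIV"
    using has_sum_lam_ser(2)[OF assms(1,3), of j] by (simp add: g_def)
  moreover have "((\<lambda>n. g (- int n)) has_sum (-1) ^ j * lam2_ser j q (1 / x)) UNIV"
  proof -
    have "(-1) ^ j * (of_nat n ^ j * lam2 q n * (1 / x) ^ n) = g (- int n)" for n
      using power_minus[of "of_nat n :: complex" j]
      by (simp add: g_def power_int_minus power_one_over inverse_eq_divide)
    then show ?thesis
      using has_sum_cmult_right[OF has_sum_lam_ser(2)[OF assms(1) inv, of j], of "(-1) ^ j"] by simp
  qed
  ultimately have "(g has_sum (lam2_ser j q x + (-1) ^ j * lam2_ser j q (1 / x) - g 0)) UNIV"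
    by (rule has_sum_int_UNIV)
  moreover have "(g has_sum eser j q x) UNIV"
    using has_sum_eser[OF assms, of j] by (simp add: g_def)
  ultimately have "lam2_ser j q x + (-1) ^ j * lam2_ser j q (1 / x) - g 0 = eser j q x"
    by (rule has_sum_unique)
  then show ?thesis by (simp add: g_def)
qed

text \<open>The continuation of \<open>f\<close> across the unit circle away from
  \<open>x = 1\<close>: the part of the coefficients that does not decay is summed in closed form,
  and the remaining Lambert series converge there.\<close>

definition kfun0 :: "complex \<Rightarrow> complex \<Rightarrow> complex" where
  "kfun0 q x = 1 / (1 - x) - 1 / 2 + lam1_ser 0 q x - lam1_ser 0 q (1 / x)"

text \<open>The same continuation for \<open>\<theta>f\<close>; the first summand is
  \<open>\<theta>\<close> applied to \<open>1 / (1 - x)\<close>.\<close>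

definition kfun1 :: "complex \<Rightarrow> complex \<Rightarrow> complex" where
  "kfun1 q x = x / (1 - x) ^ 2 + lam1_ser 1 q x + lam1_ser 1 q (1 / x)"

lemma kser_eq:
  assumes "norm q < norm x" "norm x < 1"
  shows "kser 0 q x = kfun0 q x" "kser 1 q x = kfun1 q x"
proof -
  have q1: "norm q < 1" using assms by linarith
  have qx: "norm q * norm x < 1"
    using mult_strict_mono'[of "norm q" 1 "norm x" 1] q1 assms by simp
  have x0: "x \<noteq> 0" using assms norm_ge_zero[of q] by auto
  have inv: "norm q * norm (1 / x) < 1"
    using assms x0 by (simp add: norm_divide divide_simps)
  have geom: "((\<lambda>n. x ^ n) has_sum 1 / (1 - x)) UNIV"
    using assms by (intro norm_summable_imp_has_sum geometric_sums) (simp_all add: norm_power summable_geometric)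
  have geom': "((\<lambda>n. of_nat n * x ^ n) has_sum x / (1 - x) ^ 2) UNIV"
  proof (rule norm_summable_imp_has_sum)
    show "summable (\<lambda>n. norm (of_nat n * x ^ n))"
      using summable_power_times_geometric[of "norm x" 1] assms by (simp add: norm_mult norm_power)
    have "(\<lambda>n. x * (of_nat (Suc n) * x ^ n)) sums (x * (1 / (1 - x) ^ 2))"
      by (intro sums_mult geometric_deriv_sums assms)
    then have "(\<lambda>n. of_nat (Suc n) * x ^ Suc n) sums (x / (1 - x) ^ 2)"
      by (simp add: mult_ac del: of_nat_Suc)
    then show "(\<lambda>n. of_nat n * x ^ n) sums (x / (1 - x) ^ 2)"
      by (subst (asm) sums_Suc_iff) simp
  qed
  note has_sums = has_sum_lam_ser(1)[OF q1 qx] has_sum_lam_ser(1)[OF q1 inv]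
  have pow: "x powi - int n = (1 / x) ^ n" for n
    by (simp add: power_int_minus power_one_over inverse_eq_divide)
  show "kser 0 q x = kfun0 q x"
  proof -
    define g where "g = (\<lambda>n::int. kcoeff q n * x powi n)"
    \<comment> \<open>The correction at \<open>n = 0\<close> lowers the constant term of the
      geometric series from \<open>1\<close> to \<open>kcoeff q 0 = 1 / 2\<close>.\<close>
    have "((\<lambda>n. x ^ n + (of_nat n ^ 0 * lam1 q n * x ^ n) + (if n = 0 then - 1 / 2 else 0)) has_sum
        (1 / (1 - x) + lam1_ser 0 q x + - 1 / 2)) UNIV"
      by (intro has_sum_add geom has_sums has_sum_delta)
    moreover have "x ^ n + (of_nat n ^ 0 * lam1 q n * x ^ n) + (if n = 0 then - 1 / 2 else 0) = g (int n)" for n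
      by (simp add: g_def kcoeff_def algebra_simps)
    ultimately have 1: "((\<lambda>n. g (int n)) has_sum (1 / (1 - x) + lam1_ser 0 q x + - 1 / 2)) UNIV" by simp
    have "((\<lambda>n. - (of_nat n ^ 0 * lam1 q n * (1 / x) ^ n) + (if n = 0 then 1 / 2 else 0)) has_sum
        (- lam1_ser 0 q (1 / x) + 1 / 2)) UNIV"
      by (intro has_sum_add has_sum_neg has_sums has_sum_delta)
    moreover have "- (of_nat n ^ 0 * lam1 q n * (1 / x) ^ n) + (if n = 0 then 1 / 2 else 0) = g (- int n)" for n
      by (simp add: g_def kcoeff_def pow)
    ultimately have 2: "((\<lambda>n. g (- int n)) has_sum (- lam1_ser 0 q (1 / x) + 1 / 2)) UNIV" by simp
    have "(g has_sum kser 0 q x) UNIV"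
      using has_sum_kser[OF assms, of 0] by (simp add: g_def)
    from has_sum_unique[OF this has_sum_int_UNIV[OF 1 2]] show ?thesis
      by (simp add: kfun0_def g_def)
  qed
  show "kser 1 q x = kfun1 q x"
  proof -
    define g where "g = (\<lambda>n::int. of_int n * kcoeff q n * x powi n)"
    have "((\<lambda>n. of_nat n * x ^ n + (of_nat n ^ 1 * lam1 q n * x ^ n)) has_sum
        (x / (1 - x) ^ 2 + lam1_ser 1 q x)) UNIV"
      by (intro has_sum_add geom' has_sums)
    moreover have "of_nat n * x ^ n + (of_nat n ^ 1 * lam1 q n * x ^ n) = g (int n)" for n
      by (simp add: g_def kcoeff_def algebra_simps)
    ultimately have 1: "((\<lambda>n. g (int n)) has_sum (x / (1 - x) ^ 2 + lam1_ser 1 q x)) UNIV" by simp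
    have "of_nat n ^ 1 * lam1 q n * (1 / x) ^ n = g (- int n)" for n
      by (simp add: g_def kcoeff_def pow)
    then have 2: "((\<lambda>n. g (- int n)) has_sum lam1_ser 1 q (1 / x)) UNIV"
      using has_sums(2)[of 1] by simp
    have "(g has_sum kser 1 q x) UNIV"
      using has_sum_kser[OF assms, of 1] by (simp add: g_def)
    from has_sum_unique[OF this has_sum_int_UNIV[OF 1 2]] show ?thesis
      by (simp add: kfun1_def g_def)
  qed
qed

text \<open>The boundary value of \<open>kser 2\<close>, obtained by applying \<open>\<theta>\<close> to \<open>f\<^sup>2 = \<theta>f - 2e + const\<close>.\<close>

definition kfun2 :: "complex \<Rightarrow> complex \<Rightarrow> complex" where
  "kfun2 q x = 2 * kfun0 q x * kfun1 q x + 2 * eser 1 q x"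

text \<open>Inside the annulus \<open>kser\<close> agrees with \<open>kfun0\<close> and
  \<open>kfun1\<close>, which are continuous at \<open>x\<close>; order \<open>2\<close> follows
  from the differentiated square identity. A general path \<open>z\<close> is allowed so that
  products of two radial paths are covered as well.\<close>

lemma tendsto_kser_circle:
  assumes q: "norm q < 1" and x: "norm x = 1" "x \<noteq> 1"
    and z: "(z \<longlongrightarrow> x) F" and ev: "eventually (\<lambda>r. norm q < norm (z r) \<and> norm (z r) < 1) F"
  shows "((\<lambda>r. kser 0 q (z r)) \<longlongrightarrow> kfun0 q x) F"
    and "((\<lambda>r. kser 1 q (z r)) \<longlongrightarrow> kfun1 q x) F"
    and "((\<lambda>r. kser 2 q (z r)) \<longlongrightarrow> kfun2 q x) F"
    and "((\<lambda>r. eser j q (z r)) \<longlongrightarrow> eser j q x) F"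
proof -
  have x0: "x \<noteq> 0" using x by auto
  have qx: "norm q * norm x < 1" "norm q * norm (1 / x) < 1" "norm q < norm x"
    using q x by (simp_all add: norm_divide)
  have zi: "((\<lambda>r. 1 / z r) \<longlongrightarrow> 1 / x) F"
    by (intro tendsto_intros z x0)
  note comp = isCont_tendsto_compose[OF isCont_lam_ser(1)[OF q qx(1)] z]
    isCont_tendsto_compose[OF isCont_lam_ser(1)[OF q qx(2)] zi]
    isCont_tendsto_compose[OF isCont_lam_ser(2)[OF q qx(1)] z]
    isCont_tendsto_compose[OF isCont_lam_ser(2)[OF q qx(2)] zi]
  have "((\<lambda>r. kfun0 q (z r)) \<longlongrightarrow> kfun0 q x) F"
    unfolding kfun0_def using x by (intro tendsto_intros z comp) auto
  then show k0: "((\<lambda>r. kser 0 q (z r)) \<longlongrightarrow> kfun0 q x) F"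
    by (rule Lim_transform_eventually) (use ev in \<open>auto elim!: eventually_mono simp: kser_eq simp del: One_nat_def\<close>)
  have "((\<lambda>r. kfun1 q (z r)) \<longlongrightarrow> kfun1 q x) F"
    unfolding kfun1_def using x by (intro tendsto_intros z comp) auto
  then show k1: "((\<lambda>r. kser 1 q (z r)) \<longlongrightarrow> kfun1 q x) F"
    by (rule Lim_transform_eventually) (use ev in \<open>auto elim!: eventually_mono simp: kser_eq simp del: One_nat_def\<close>)
  show e: "((\<lambda>r. eser j q (z r)) \<longlongrightarrow> eser j q x) F" for j
  proof -
    have "((\<lambda>r. lam2_ser j q (z r) + (-1) ^ j * lam2_ser j q (1 / z r)) \<longlongrightarrow>
       lam2_ser j q x + (-1) ^ j * lam2_ser j q (1 / x)) F"
      by (intro tendsto_intros comp)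
    moreover have "eventually (\<lambda>r. lam2_ser j q (z r) + (-1) ^ j * lam2_ser j q (1 / z r) = eser j q (z r)) F"
      using ev
    proof eventually_elim
      case (elim r)
      then have "norm q * norm (z r) < 1"
        using mult_strict_mono'[of "norm q" 1 "norm (z r)" 1] q by simp
      then show ?case using eser_eq[OF q, of "z r" j] elim by simp
    qed
    ultimately show ?thesis
      unfolding eser_eq[OF q qx(3,1), of j] by (rule Lim_transform_eventually)
  qed
  have "((\<lambda>r. 2 * kser 0 q (z r) * kser 1 q (z r) + 2 * eser 1 q (z r)) \<longlongrightarrow> kfun2 q x) F"
    unfolding kfun2_def by (intro tendsto_intros k0 k1 e)
  then show "((\<lambda>r. kser 2 q (z r)) \<longlongrightarrow> kfun2 q x) F"
    by (rule Lim_transform_eventually) (use ev in \<open>auto elim!: eventually_mono simp: kser_square(2) simp del: One_nat_def\<close>)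
qed

section \<open>Passage of the identities to the unit circle\<close>

lemma tendsto_unique_eventually:
  fixes f g :: "'a \<Rightarrow> 'b :: t2_space"
  assumes "F \<noteq> bot" "(f \<longlongrightarrow> l) F" "(g \<longlongrightarrow> m) F" "eventually (\<lambda>r. f r = g r) F"
  shows "l = m"
  using tendsto_unique[OF assms(1) Lim_transform_eventually[OF assms(2,4)] assms(3)] .

lemma tendsto_radial: "((\<lambda>r. of_real r * x) \<longlongrightarrow> (x :: complex)) (at_left 1)"
proof -
  have "((\<lambda>r. of_real r * x) \<longlongrightarrow> of_real 1 * x) (at_left 1)"
    by (intro tendsto_intros)
  then show ?thesis by simp
qed

lemma kfun_square:
  assumes q: "norm q < 1" and x: "norm x = 1" "x \<noteq> 1"
  shows "kfun0 q x ^ 2 = kfun1 q x - 2 * eser 0 q x + (1 / 4 - eser 0 q 1)"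
proof -
  have ev: "eventually (\<lambda>r. norm q < norm (of_real r * x) \<and> norm (of_real r * x) < 1) (at_left 1)"
    using eventually_at_left_real[OF q]
  proof eventually_elim
    case (elim r)
    have "0 \<le> norm q" by simp
    then have "0 < r" using elim by (meson greaterThanLessThan_iff le_less_trans)
    then show ?case using elim x by (simp add: norm_mult)
  qed
  note lim = tendsto_kser_circle[OF q x tendsto_radial ev]
  have "((\<lambda>r. kser 0 q (of_real r * x) ^ 2) \<longlongrightarrow> kfun0 q x ^ 2) (at_left 1)"
    by (intro tendsto_intros lim)
  moreover have "((\<lambda>r. kser 1 q (of_real r * x) - 2 * eser 0 q (of_real r * x) + (1 / 4 - eser 0 q 1)) \<longlongrightarrow>
     kfun1 q x - 2 * eser 0 q x + (1 / 4 - eser 0 q 1)) (at_left 1)"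
    by (intro tendsto_intros lim)
  moreover have "eventually (\<lambda>r. kser 0 q (of_real r * x) ^ 2 =
      kser 1 q (of_real r * x) - 2 * eser 0 q (of_real r * x) + (1 / 4 - eser 0 q 1)) (at_left 1)"
    using ev by eventually_elim (auto simp: kser_square(1))
  ultimately show ?thesis
    by (rule tendsto_unique_eventually[OF trivial_limit_at_left_real])
qed

lemma kfun_addition:
  assumes q: "norm q < 1" and x: "norm x = 1" "x \<noteq> 1" and y: "norm y = 1" "y \<noteq> 1" and xy: "x * y \<noteq> 1"
  shows "kfun0 q x * kfun0 q y - kfun0 q (x * y) * (kfun0 q x + kfun0 q y)
           = - 1 / 4 + eser 0 q (x * y) + eser 0 q x + eser 0 q y" (is ?th0)
    and "kfun1 q x * kfun0 q y - kfun0 q x * kfun1 q y - kfun0 q (x * y) * (kfun1 q x - kfun1 q y)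
           = eser 1 q x - eser 1 q y" (is ?th1)
    and "kfun2 q x * kfun0 q y - 2 * kfun1 q x * kfun1 q y + kfun0 q x * kfun2 q y
             - kfun0 q (x * y) * (kfun2 q x + kfun2 q y)
           = eser 2 q x + eser 2 q y" (is ?th2)
proof -
  define F :: "real filter" where "F = at_left 1"
  define X Y where "X = (\<lambda>r. of_real r * x)" and "Y = (\<lambda>r. of_real r * y)"
  have X: "(X \<longlongrightarrow> x) F" and Y: "(Y \<longlongrightarrow> y) F"
    unfolding X_def Y_def F_def by (rule tendsto_radial)+
  have XY: "((\<lambda>r. X r * Y r) \<longlongrightarrow> x * y) F"
    by (intro tendsto_intros X Y)
  have nb: "F \<noteq> bot" by (simp add: F_def)
  have nxy: "norm (x * y) = 1" using x y by (simp add: norm_mult)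
  \<comment> \<open>The product \<open>X r * Y r\<close> has norm \<open>r * r\<close>, and
    \<open>r > sqrt (norm q)\<close> keeps it in the annulus.\<close>
  have ev: "eventually (\<lambda>r. sqrt (norm q) < r \<and> r < 1) F"
    using eventually_at_left_real[of "sqrt (norm q)" 1] q by (simp add: F_def)
  have sq: "norm q < r \<and> norm q < r * r \<and> r * r < 1" if "sqrt (norm q) < r" "r < 1" for r
  proof -
    have "0 \<le> sqrt (norm q)" by simp
    then have r0: "0 < r" using that by linarith
    have "norm q = sqrt (norm q) * sqrt (norm q)" by simp
    also have "\<dots> < r * r" using that r0 by (intro mult_strict_mono) auto
    finally have "norm q < r * r" .
    moreover have "r * r < r" using r0 that by simp
    ultimately show ?thesis using that by linarith
  qed
  have ev': "eventually (\<lambda>r. norm q < norm (X r) \<and> norm (X r) < 1 \<and> norm q < norm (Y r) \<and> norm (Y r) < 1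
      \<and> norm q < norm (X r * Y r) \<and> norm (X r * Y r) < 1) F"
    using ev
  proof eventually_elim
    case (elim r)
    have "0 \<le> sqrt (norm q)" by simp
    then have "0 < r" using elim by linarith
    then show ?case using sq[of r] elim x y by (auto simp: X_def Y_def norm_mult)
  qed
  note lX = tendsto_kser_circle[OF q x X eventually_mono[OF ev']]
  note lY = tendsto_kser_circle[OF q y Y eventually_mono[OF ev']]
  note lXY = tendsto_kser_circle[OF q nxy xy XY eventually_mono[OF ev']]
  note unique = tendsto_unique_eventually[OF nb]
  show ?th0
    by (rule unique[where f = "\<lambda>r. kser 0 q (X r) * kser 0 q (Y r)
           - kser 0 q (X r * Y r) * (kser 0 q (X r) + kser 0 q (Y r))"
         and g = "\<lambda>r. - 1 / 4 + eser 0 q (X r * Y r) + eser 0 q (X r) + eser 0 q (Y r)"])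
       ((intro tendsto_intros lX lY lXY; blast),
        (intro tendsto_intros lX lY lXY; blast),
        (rule eventually_mono[OF ev'], intro kser_addition(1), auto))
  show ?th1
    by (rule unique[where f = "\<lambda>r. kser 1 q (X r) * kser 0 q (Y r) - kser 0 q (X r) * kser 1 q (Y r)
           - kser 0 q (X r * Y r) * (kser 1 q (X r) - kser 1 q (Y r))"
         and g = "\<lambda>r. eser 1 q (X r) - eser 1 q (Y r)"])
       ((intro tendsto_intros lX lY lXY; blast),
        (intro tendsto_intros lX lY lXY; blast),
        (rule eventually_mono[OF ev'], intro kser_addition(2), auto))
  show ?th2
    by (rule unique[where f = "\<lambda>r. kser 2 q (X r) * kser 0 q (Y r) - 2 * kser 1 q (X r) * kser 1 q (Y r)
           + kser 0 q (X r) * kser 2 q (Y r) - kser 0 q (X r * Y r) * (kser 2 q (X r) + kser 2 q (Y r))"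
         and g = "\<lambda>r. eser 2 q (X r) + eser 2 q (Y r)"])
       ((intro tendsto_intros lX lY lXY; blast),
        (intro tendsto_intros lX lY lXY; blast),
        (rule eventually_mono[OF ev'], intro kser_addition(3), auto))
qed

section \<open>Lambert series as power series in the nome\<close>

text \<open>The double series over \<open>(n, k)\<close> is regrouped by \<open>N = n * k\<close>,
  which turns a Lambert series into a power series with divisor sums as coefficients.\<close>

lemma lambert_rearrange:
  fixes h :: "nat \<Rightarrow> nat \<Rightarrow> complex"
  assumes h: "\<And>n k. n > 0 \<Longrightarrow> k > 0 \<Longrightarrow> norm (h n k) \<le> real (n * k) ^ p"
    and q: "norm q < 1"
    and g: "\<And>n. n > 0 \<Longrightarrow> (\<lambda>k. h n (Suc k) * q ^ (n * Suc k)) sums g n"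
  shows "(\<lambda>n. g (Suc n)) sums (\<Sum>N. (\<Sum>d | d dvd Suc N. h d (Suc N div d)) * q ^ Suc N)"
proof -
  define F where "F = (\<lambda>(n, k). h (Suc n) (Suc k) * q ^ (Suc n * Suc k))"
  \<comment> \<open>Since \<open>(n + 1) * (k + 1) \<ge> n + k\<close>, the double series is
    dominated by the product of two single series with terms \<open>G\<close>.\<close>
  define G where "G = (\<lambda>n. real (Suc n) ^ p * norm q ^ n)"
  have le: "norm (F (n, k)) \<le> G n * G k" for n k
  proof -
    have "norm q ^ (Suc n * Suc k) \<le> norm q ^ (n + k)"
      using q by (intro power_decreasing) auto
    then have "norm (h (Suc n) (Suc k)) * norm q ^ (Suc n * Suc k)
       \<le> real (Suc n * Suc k) ^ p * norm q ^ (n + k)"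
      by (intro mult_mono h) auto
    then show ?thesis
      unfolding F_def G_def prod.case norm_mult norm_power of_nat_mult power_mult_distrib power_add
      by (simp only: mult_ac)
  qed
  have G: "summable G"
  proof -
    have "summable (\<lambda>n. diffs (\<lambda>n. real n ^ p) n * norm q ^ n)"
      using summable_power_times_geometric[of _ p] q by (intro termdiff_converges[where K = 1]) auto
    then show ?thesis
    proof (rule summable_comparison_test')
      fix n
      have "real (Suc n) ^ p * norm q ^ n * 1 \<le> real (Suc n) ^ p * norm q ^ n * real (Suc n)"
        by (intro mult_left_mono) auto
      then show "norm (G n) \<le> diffs (\<lambda>n. real n ^ p) n * norm q ^ n"
        by (simp add: G_def diffs_def abs_mult mult_ac del: of_nat_Suc)
    qed
  qed
  have "G n \<ge> 0" for n by (simp add: G_def)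
  then have "summable (\<lambda>n. norm (G n))" using G by simp
  from norm_summable_imp_summable_on[OF this] have G': "G summable_on UNIV" .
  have "(\<lambda>z. G (fst z) * G (snd z)) summable_on UNIV \<times> UNIV"
  proof (rule summable_on_SigmaI)
    show "((\<lambda>y. G (fst (x, y)) * G (snd (x, y))) has_sum (G x * infsum G UNIV)) UNIV" for x
      using has_sum_cmult_right[OF has_sum_infsum[OF G']] by simp
    show "(\<lambda>x. G x * infsum G UNIV) summable_on UNIV"
      by (rule summable_on_cmult_left[OF G'])
  qed (simp add: G_def)
  then have "(\<lambda>z. norm (F z)) summable_on UNIV"
    by (intro summable_on_comparison_test[where g = "\<lambda>z. norm (F z)" and f = "\<lambda>z. G (fst z) * G (snd z)"])
       (use le in auto)
  then have normF: "(\<lambda>z. norm (F z)) summable_on UNIV \<times> UNIV" by simp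
  then obtain S where S: "(F has_sum S) (UNIV \<times> UNIV)"
    using abs_summable_summable summable_on_def by blast
  have "((\<lambda>n. g (Suc n)) has_sum S) UNIV"
  proof (rule has_sum_SigmaD[OF S])
    fix n
    have "(\<lambda>k. norm (F (n, k))) summable_on UNIV"
      using summable_on_SigmaD1[of "\<lambda>n k. norm (F (n, k))" UNIV "\<lambda>_. UNIV" n] normF
      by (simp add: case_prod_unfold)
    then have "summable (\<lambda>k. norm (F (n, k)))"
      by (rule summable_on_imp_summable)
    moreover have "(\<lambda>k. F (n, k)) sums g (Suc n)"
      using g[of "Suc n"] by (simp add: F_def)
    ultimately show "((\<lambda>k. F (n, k)) has_sum g (Suc n)) UNIV"
      by (rule norm_summable_imp_has_sum)
  qed
  then have 1: "(\<lambda>n. g (Suc n)) sums S" by (rule has_sum_imp_sums)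
  define H where "H = (\<lambda>(N, d). h d (Suc N div d) * q ^ Suc N)"
  \<comment> \<open>All indices are shifted by one: \<open>N + 1 = (n + 1) * (k + 1)\<close>, and
    the divisor is \<open>n + 1\<close>.\<close>
  have bij: "bij_betw (\<lambda>(n, k). (Suc n * Suc k - 1, Suc n)) (UNIV \<times> UNIV) (SIGMA N:UNIV. {d. d dvd Suc N})"
  proof (rule bij_betwI[where g = "\<lambda>(N, d). (d - 1, Suc N div d - 1)"])
    show "(\<lambda>(N, d). (d - 1, Suc N div d - 1)) \<in> (SIGMA N:UNIV. {d. d dvd Suc N}) \<rightarrow> UNIV \<times> UNIV" by auto
  next
    fix z :: "nat \<times> nat" assume "z \<in> (SIGMA N:UNIV. {d. d dvd Suc N})"
    then obtain N d where z: "z = (N, d)" and d: "d dvd Suc N" by auto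
    then have "d > 0" by (auto intro: Nat.gr0I)
    moreover from d \<open>d > 0\<close> have "Suc N div d > 0"
      by (simp add: div_greater_zero_iff dvd_imp_le)
    ultimately show "(case case z of (N, d) \<Rightarrow> (d - 1, Suc N div d - 1) of
        (n, k) \<Rightarrow> (Suc n * Suc k - 1, Suc n)) = z"
      using d by (simp add: z del: mult_Suc mult_Suc_right)
  next
    fix z :: "nat \<times> nat"
    show "(case case z of (n, k) \<Rightarrow> (Suc n * Suc k - 1, Suc n) of (N, d) \<Rightarrow> (d - 1, Suc N div d - 1)) = z"
    proof (cases z)
      case (Pair n k)
      have "Suc (Suc n * Suc k - 1) = Suc n * Suc k" by simp
      then show ?thesis unfolding Pair by (simp del: mult_Suc mult_Suc_right)
    qed
  next
    show "(\<lambda>(n, k). (Suc n * Suc k - 1, Suc n)) \<in> UNIV \<times> UNIV \<rightarrow> (SIGMA N:UNIV. {d. d dvd Suc N})"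
    proof (rule funcsetI)
      fix z :: "nat \<times> nat"
      obtain n k where z: "z = (n, k)" by (cases z)
      have "Suc (Suc n * Suc k - 1) = Suc n * Suc k" by simp
      then have "Suc n dvd Suc (Suc n * Suc k - 1)" by (simp only: dvd_triv_left)
      then show "(case z of (n, k) \<Rightarrow> (Suc n * Suc k - 1, Suc n)) \<in> (SIGMA N:UNIV. {d. d dvd Suc N})"
        unfolding z prod.case by (intro SigmaI UNIV_I CollectI)
    qed
  qed
  have "F z = H ((\<lambda>(n, k). (Suc n * Suc k - 1, Suc n)) z)" for z
  proof (cases z)
    case (Pair n k)
    have "Suc (Suc n * Suc k - 1) = Suc n * Suc k" by simp
    then show ?thesis unfolding Pair F_def H_def by (simp del: mult_Suc mult_Suc_right power_Suc)
  qed
  then have "F = (\<lambda>z. H ((\<lambda>(n, k). (Suc n * Suc k - 1, Suc n)) z))" by (rule ext)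
  with S have "((\<lambda>z. H ((\<lambda>(n, k). (Suc n * Suc k - 1, Suc n)) z)) has_sum S) (UNIV \<times> UNIV)"
    by (simp only:)
  then have "(H has_sum S) (SIGMA N:UNIV. {d. d dvd Suc N})"
    by (rule has_sum_reindex_bij_betw[OF bij, THEN iffD1])
  then have "((\<lambda>N. (\<Sum>d | d dvd Suc N. h d (Suc N div d)) * q ^ Suc N) has_sum S) UNIV"
  proof (rule has_sum_SigmaD)
    fix N
    show "((\<lambda>d. H (N, d)) has_sum (\<Sum>d | d dvd Suc N. h d (Suc N div d)) * q ^ Suc N) {d. d dvd Suc N}"
      unfolding H_def prod.case sum_distrib_right by (rule has_sum_finite) (simp add: finite_divisors_nat)
  qed
  then have "(\<lambda>N. (\<Sum>d | d dvd Suc N. h d (Suc N div d)) * q ^ Suc N) sums S"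
    by (rule has_sum_imp_sums)
  with 1 show ?thesis by (simp add: sums_iff)
qed

definition divisor_coeff :: "nat \<Rightarrow> complex \<Rightarrow> nat \<Rightarrow> complex" where
  "divisor_coeff j x N = (\<Sum>d | d dvd N. of_nat d ^ j * x ^ d)"

text \<open>Every natural number divides \<open>0\<close>, so the sum runs over an infinite set and
  takes its default value.\<close>

lemma divisor_coeff_0 [simp]: "divisor_coeff j x 0 = 0"
  by (simp add: divisor_coeff_def)

lemma norm_divisor_coeff_le:
  assumes x: "norm x = 1"
  shows "norm (divisor_coeff j x N) \<le> real N ^ Suc j"
proof (cases "N = 0")
  case False
  have "norm (divisor_coeff j x N) \<le> (\<Sum>d | d dvd N. norm (of_nat d ^ j * x ^ d))"
    unfolding divisor_coeff_def by (rule norm_sum)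
  also have "\<dots> = (\<Sum>d | d dvd N. real d ^ j)"
    using x by (simp add: norm_mult norm_power)
  also have "\<dots> \<le> (\<Sum>d\<in>{1..N}. real d ^ j)"
    using False by (intro sum_mono2) (auto dest: dvd_imp_le intro: Nat.gr0I simp: Suc_le_eq)
  also have "\<dots> \<le> (\<Sum>d\<in>{1..N}. real N ^ j)"
    by (intro sum_mono power_mono) auto
  finally show ?thesis by simp
qed simp

lemma geometric_Suc_sums:
  fixes z :: complex
  assumes "norm z < 1"
  shows "(\<lambda>k. z ^ Suc k) sums (z / (1 - z))" "(\<lambda>k. of_nat (Suc k) * z ^ Suc k) sums (z / (1 - z) ^ 2)"
  using sums_mult[OF geometric_sums[OF assms], of z] sums_mult[OF geometric_deriv_sums[OF assms], of z]
  by (simp_all add: mult_ac del: of_nat_Suc)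

text \<open>Expanding \<open>lam1\<close> and \<open>lam2\<close> in powers of \<open>q ^ n\<close>
  gives double series with weights \<open>1\<close> and \<open>k\<close>. In the second, one factor
  \<open>n\<close> joins the weight \<open>k\<close> to form \<open>n * k = N\<close>, hence the
  factor \<open>of_nat N\<close>.\<close>

lemma lam1_ser_powser:
  assumes q: "norm q < 1" and x: "norm x = 1"
  shows "lam1_ser j q x = (\<Sum>N. divisor_coeff j x N * q ^ N)"
    and "lam2_ser (Suc j) q x = (\<Sum>N. of_nat N * divisor_coeff j x N * q ^ N)"
proof -
  have summ: "summable (\<lambda>N. of_nat N ^ i * divisor_coeff j x N * q ^ N)" for i
  proof (rule summable_comparison_test')
    show "summable (\<lambda>N. real N ^ (i + Suc j) * norm q ^ N)"
      using q by (intro summable_power_times_geometric) simp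
    show "norm (of_nat N ^ i * divisor_coeff j x N * q ^ N) \<le> real N ^ (i + Suc j) * norm q ^ N" for N
      unfolding norm_mult norm_power norm_of_nat power_add
      by (intro mult_left_mono mult_right_mono norm_divisor_coeff_le x) auto
  qed
  have qn: "norm (q ^ n) < 1" if "n > 0" for n
    using that q by (simp add: norm_power power_less_one_iff)
  have "(\<lambda>n. of_nat (Suc n) ^ j * x ^ Suc n * lam1 q (Suc n)) sums
    (\<Sum>N. (\<Sum>d | d dvd Suc N. of_nat d ^ j * x ^ d) * q ^ Suc N)"
  proof (rule lambert_rearrange[OF _ q])
    show "norm (of_nat n ^ j * x ^ n) \<le> real (n * k) ^ j" if "n > 0" "k > 0" for n k
      using x that by (simp add: norm_mult norm_power power_mono)
    show "(\<lambda>k. of_nat n ^ j * x ^ n * q ^ (n * Suc k)) sums (of_nat n ^ j * x ^ n * lam1 q n)" if "n > 0" for n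
      using sums_mult[OF geometric_Suc_sums(1)[OF qn[OF that]]]
      unfolding lam1_def power_mult .
  qed
  then have "(\<lambda>n. of_nat n ^ j * x ^ n * lam1 q n) sums
    (\<Sum>N. (\<Sum>d | d dvd Suc N. of_nat d ^ j * x ^ d) * q ^ Suc N)"
    by (subst (asm) sums_Suc_iff) simp
  moreover have "(\<Sum>N. (\<Sum>d | d dvd Suc N. of_nat d ^ j * x ^ d) * q ^ Suc N)
      = (\<Sum>N. divisor_coeff j x N * q ^ N)"
    using suminf_split_head[OF summ[of 0]] by (simp add: divisor_coeff_def)
  ultimately show "lam1_ser j q x = (\<Sum>N. divisor_coeff j x N * q ^ N)"
    by (simp add: lam1_ser_def sums_iff mult_ac)
  have "(\<lambda>n. of_nat (Suc n) ^ Suc j * x ^ Suc n * lam2 q (Suc n)) sums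
    (\<Sum>N. (\<Sum>d | d dvd Suc N. of_nat d ^ j * x ^ d * of_nat (d * (Suc N div d))) * q ^ Suc N)"
  proof (rule lambert_rearrange[OF _ q])
    show "norm (of_nat n ^ j * x ^ n * of_nat (n * k)) \<le> real (n * k) ^ Suc j" if "n > 0" "k > 0" for n k
    proof -
      have "norm (of_nat n ^ j * x ^ n) \<le> real (n * k) ^ j"
        using x that by (simp add: norm_mult norm_power power_mono)
      then have "norm (of_nat n ^ j * x ^ n) * real (n * k) \<le> real (n * k) ^ j * real (n * k)"
        by (rule mult_right_mono) simp
      then show ?thesis
        unfolding norm_mult[of _ "of_nat (n * k)"] norm_of_nat power_Suc by (simp only: mult_ac)
    qed
    show "(\<lambda>k. of_nat n ^ j * x ^ n * of_nat (n * Suc k) * q ^ (n * Suc k)) sums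
        (of_nat n ^ Suc j * x ^ n * lam2 q n)" if "n > 0" for n
      using sums_mult[OF geometric_Suc_sums(2)[OF qn[OF that]], of "of_nat n ^ Suc j * x ^ n"]
      unfolding lam2_def power_mult by (simp add: mult_ac del: of_nat_Suc mult_Suc_right)
  qed
  then have "(\<lambda>n. of_nat n ^ Suc j * x ^ n * lam2 q n) sums
    (\<Sum>N. (\<Sum>d | d dvd Suc N. of_nat d ^ j * x ^ d * of_nat (d * (Suc N div d))) * q ^ Suc N)"
    by (subst (asm) sums_Suc_iff) simp
  moreover have "(\<Sum>d | d dvd Suc N. of_nat d ^ j * x ^ d * of_nat (d * (Suc N div d)))
      = of_nat (Suc N) * divisor_coeff j x (Suc N)" for N
    unfolding divisor_coeff_def sum_distrib_left by (rule sum.cong) (auto simp: mult_ac simp del: of_nat_Suc)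
  moreover have "(\<Sum>N. of_nat (Suc N) * divisor_coeff j x (Suc N) * q ^ Suc N)
      = (\<Sum>N. of_nat N * divisor_coeff j x N * q ^ N)"
    using suminf_split_head[OF summ[of 1]] by simp
  ultimately show "lam2_ser (Suc j) q x = (\<Sum>N. of_nat N * divisor_coeff j x N * q ^ N)"
    unfolding lam2_ser_def by (simp only: sums_iff mult_ac)
qed

lemma lam2_ser_sigma1:
  assumes q: "norm q < 1"
  shows "lam2_ser 0 q 1 = (\<Sum>N. of_nat (sigma1 (Suc N)) * q ^ Suc N)"
proof -
  have "(\<lambda>n. lam2 q (Suc n)) sums (\<Sum>N. (\<Sum>d | d dvd Suc N. of_nat (Suc N div d)) * q ^ Suc N)"
  proof (rule lambert_rearrange[OF _ q])
    show "norm (of_nat k :: complex) \<le> real (n * k) ^ 1" if "n > 0" "k > 0" for n k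
      using that by simp
    show "(\<lambda>k. of_nat (Suc k) * q ^ (n * Suc k)) sums lam2 q n" if "n > 0" for n
    proof -
      have "norm (q ^ n) < 1" using that q by (simp add: norm_power power_less_one_iff)
      from geometric_Suc_sums(2)[OF this] show ?thesis by (simp only: lam2_def power_mult)
    qed
  qed
  then have "(\<lambda>n. lam2 q n) sums (\<Sum>N. (\<Sum>d | d dvd Suc N. of_nat (Suc N div d)) * q ^ Suc N)"
    by (subst (asm) sums_Suc_iff) simp
  \<comment> \<open>Passing to the complementary divisor permutes the divisors.\<close>
  moreover have "(\<Sum>d | d dvd Suc N. of_nat (Suc N div d)) = (of_nat (sigma1 (Suc N)) :: complex)" for N
  proof -
    have inv: "m div (m div a) = a" if "a dvd m" "m > 0" for a m :: nat
      using that by (elim dvdE) simp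
    have "(\<Sum>d | d dvd Suc N. Suc N div d) = sigma1 (Suc N)"
      unfolding sigma1_def
      by (rule sum.reindex_bij_witness[where i = "\<lambda>d. Suc N div d" and j = "\<lambda>d. Suc N div d"])
         (auto simp: inv)
    then show ?thesis by (metis of_nat_sum)
  qed
  ultimately show ?thesis
    unfolding lam2_ser_def by (simp add: sums_iff)
qed

text \<open>The operator \<open>q d/dq\<close> multiplies the coefficient of \<open>q ^ N\<close> by
  \<open>N\<close>, which is exactly the difference between the two expansions in
  \<open>lam1_ser_powser\<close>.\<close>

lemma lam1_ser_deriv:
  assumes q: "norm q < 1" and x: "norm x = 1"
  obtains D where "((\<lambda>q. lam1_ser j q x) has_field_derivative D) (at q)" "q * D = lam2_ser (Suc j) q x"
proof
  let ?c = "divisor_coeff j x"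
  let ?D = "\<Sum>n. diffs ?c n * q ^ n"
  have summ: "summable (\<lambda>n. ?c n * z ^ n)" if "norm z < 1" for z
  proof (rule summable_comparison_test')
    show "summable (\<lambda>N. real N ^ Suc j * norm z ^ N)"
      using that by (intro summable_power_times_geometric) simp
    show "norm (?c N * z ^ N) \<le> real N ^ Suc j * norm z ^ N" for N
      unfolding norm_mult norm_power by (intro mult_right_mono norm_divisor_coeff_le x) auto
  qed
  have "((\<lambda>z. \<Sum>n. ?c n * z ^ n) has_field_derivative ?D) (at q)"
    using summ q by (intro termdiffs_strong'[where K = 1]) auto
  then show "((\<lambda>q. lam1_ser j q x) has_field_derivative ?D) (at q)"
    by (rule has_field_derivative_transform_within_open[of _ _ _ "ball 0 1"])
       (use q x in \<open>auto simp: lam1_ser_powser\<close>)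
  have sd: "summable (\<lambda>n. diffs ?c n * q ^ n)"
    using summ q by (intro termdiff_converges[where K = 1]) auto
  have "(\<lambda>n. q * (diffs ?c n * q ^ n)) sums (q * ?D)"
    by (intro sums_mult summable_sums sd)
  then have "(\<lambda>n. of_nat (Suc n) * ?c (Suc n) * q ^ Suc n) sums (q * ?D)"
    by (simp add: diffs_def mult_ac del: of_nat_Suc)
  then have "(\<lambda>n. of_nat n * ?c n * q ^ n) sums (q * ?D)"
    by (subst (asm) sums_Suc_iff) simp
  then show "q * ?D = lam2_ser (Suc j) q x"
    using lam1_ser_powser(2)[OF q x, of j] by (simp add: sums_iff)
qed

section \<open>Fifth roots of unity\<close>

text \<open>These are \<open>q df/dq = \<theta>e\<close> and its image under
  \<open>\<theta>\<close>. The elementary summands do not depend on \<open>q\<close>, and the signs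
  of the Lambert parts match those in \<open>eser_eq\<close>.\<close>

lemma kfun_deriv:
  assumes q: "norm q < 1" and x: "norm x = 1"
  shows "\<exists>D. ((\<lambda>q. kfun0 q x) has_field_derivative D) (at q) \<and> q * D = eser 1 q x"
    and "\<exists>D. ((\<lambda>q. kfun1 q x) has_field_derivative D) (at q) \<and> q * D = eser 2 q x"
proof -
  have x': "norm (1 / x) = 1" using x by (simp add: norm_divide)
  have e: "eser j q x = lam2_ser j q x + (-1) ^ j * lam2_ser j q (1 / x)" for j
    using q x by (intro eser_eq) auto
  obtain D1 where D1: "((\<lambda>q. lam1_ser 0 q x) has_field_derivative D1) (at q)" "q * D1 = lam2_ser (Suc 0) q x"
    by (rule lam1_ser_deriv[OF q x])
  obtain D2 where D2: "((\<lambda>q. lam1_ser 0 q (1 / x)) has_field_derivative D2) (at q)"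
      "q * D2 = lam2_ser (Suc 0) q (1 / x)"
    by (rule lam1_ser_deriv[OF q x'])
  have "((\<lambda>q. kfun0 q x) has_field_derivative 0 + D1 - D2) (at q)"
    unfolding kfun0_def by (intro DERIV_add DERIV_diff DERIV_const D1 D2)
  moreover have "q * (0 + D1 - D2) = eser 1 q x"
    unfolding e using D1(2) D2(2) by (simp add: algebra_simps)
  ultimately show "\<exists>D. ((\<lambda>q. kfun0 q x) has_field_derivative D) (at q) \<and> q * D = eser 1 q x"
    by blast
  obtain D1 where D1: "((\<lambda>q. lam1_ser 1 q x) has_field_derivative D1) (at q)" "q * D1 = lam2_ser (Suc 1) q x"
    by (rule lam1_ser_deriv[OF q x])
  obtain D2 where D2: "((\<lambda>q. lam1_ser 1 q (1 / x)) has_field_derivative D2) (at q)"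
      "q * D2 = lam2_ser (Suc 1) q (1 / x)"
    by (rule lam1_ser_deriv[OF q x'])
  have "((\<lambda>q. kfun1 q x) has_field_derivative 0 + D1 + D2) (at q)"
    unfolding kfun1_def by (intro DERIV_add DERIV_const D1 D2)
  moreover have "q * (0 + D1 + D2) = eser 2 q x"
    unfolding e using D1(2) D2(2) by (simp add: algebra_simps numeral_2_eq_2)
  ultimately show "\<exists>D. ((\<lambda>q. kfun1 q x) has_field_derivative D) (at q) \<and> q * D = eser 2 q x"
    by blast
qed

section \<open>Parity under inversion of \<open>x\<close>, and the value of \<open>e\<close> at
  \<open>1\<close>\<close>

lemma kfun0_inverse:
  assumes "x \<noteq> 0" "x \<noteq> 1"
  shows "kfun0 q (1 / x) = - kfun0 q x"
proof -
  have "1 / (1 - 1 / x) - 1 / 2 = - (1 / (1 - x) - 1 / 2)"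
    using assms by (simp add: divide_simps) (simp add: algebra_simps)
  then show ?thesis by (simp add: kfun0_def)
qed

lemma kfun1_inverse:
  assumes "x \<noteq> 0" "x \<noteq> 1"
  shows "kfun1 q (1 / x) = kfun1 q x"
proof -
  have "1 / x / (1 - 1 / x) ^ 2 = x / (1 - x) ^ 2"
    using assms by (simp add: divide_simps) (simp add: algebra_simps power2_eq_square)
  then show ?thesis by (simp add: kfun1_def)
qed

lemma eser_inverse:
  assumes "norm q < 1" "norm x = 1"
  shows "eser j q (1 / x) = (-1) ^ j * eser j q x"
proof -
  have "(-1) ^ j * ((-1) ^ j * z) = (z :: complex)" for z
    by (simp flip: mult.assoc power_mult_distrib)
  moreover have "norm q < norm x" "norm q * norm x < 1" "norm q < norm (1 / x)" "norm q * norm (1 / x) < 1"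
    using assms by (simp_all add: norm_divide)
  ultimately show ?thesis using assms(1)
    by (simp add: eser_eq algebra_simps)
qed

text \<open>At \<open>x = 1\<close> the two halves of \<open>eser\<close> coincide, so it is twice
  the generating series of \<open>sigma1\<close>.\<close>

lemma E2_eq_eser:
  assumes "norm q < 1"
  shows "E2 q = 1 - 12 * eser 0 q 1"
  using eser_eq[of q 1 0] lam2_ser_sigma1[OF assms] assms by (simp add: E2_def)

text \<open>As \<open>1 / x = x ^ 4\<close>, the difference \<open>x ^ d - (1 / x) ^ d\<close>
  depends only on \<open>d mod 5\<close>; it vanishes for residue \<open>0\<close> and changes sign
  between opposite residues.\<close>

lemma divisor_coeff_fifth_root:
  assumes x: "x ^ 5 = 1" and N: "N > 0"
  shows "divisor_coeff 0 x N - divisor_coeff 0 (1 / x) N =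
     (x - x ^ 4) * of_int (int (dcount5 1 N) - int (dcount5 4 N))
      + (x ^ 2 - x ^ 3) * of_int (int (dcount5 2 N) - int (dcount5 3 N))"
proof -
  have fin: "finite {d. d dvd N}" using N by (rule finite_divisors_nat)
  have x0: "x \<noteq> 0" using x by auto
  have cnt: "(of_nat (dcount5 j N) :: complex) = (\<Sum>d | d dvd N. if [d = j] (mod 5) then 1 else 0)" for j
  proof -
    have "(\<Sum>d | d dvd N. if [d = j] (mod 5) then 1 else 0) = (\<Sum>d\<in>{d \<in> {d. d dvd N}. [d = j] (mod 5)}. 1 :: complex)"
      using fin by (rule sum.inter_filter[symmetric])
    also have "\<dots> = of_nat (dcount5 j N)" by (simp add: dcount5_def)
    finally show ?thesis ..
  qed
  have pow: "x ^ d = x ^ (d mod 5)" for d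
  proof -
    have "x ^ d = (x ^ 5) ^ (d div 5) * x ^ (d mod 5)"
      by (simp flip: power_mult power_add)
    then show ?thesis using x by simp
  qed
  have "x * x ^ 4 = x ^ 5" by (simp add: eval_nat_numeral)
  then have inv: "1 / x = x ^ 4" using x x0 by (simp add: field_simps)
  have pointwise: "x ^ d - (1 / x) ^ d =
      (x - x ^ 4) * ((if [d = 1] (mod 5) then 1 else 0) - (if [d = 4] (mod 5) then 1 else 0))
      + (x ^ 2 - x ^ 3) * ((if [d = 2] (mod 5) then 1 else 0) - (if [d = 3] (mod 5) then 1 else 0))" for d
  proof -
    have "(1 / x) ^ d = x ^ (4 * (d mod 5) mod 5)"
      unfolding inv using pow[of "4 * d"] by (simp add: mod_mult_right_eq flip: power_mult)
    moreover have "x ^ d = x ^ (d mod 5)" by (rule pow)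
    moreover consider "d mod 5 = 0" | "d mod 5 = 1" | "d mod 5 = 2" | "d mod 5 = 3" | "d mod 5 = 4"
      by linarith
    then have "x ^ (d mod 5) - x ^ (4 * (d mod 5) mod 5) =
      (x - x ^ 4) * ((if [d = 1] (mod 5) then 1 else 0) - (if [d = 4] (mod 5) then 1 else 0))
      + (x ^ 2 - x ^ 3) * ((if [d = 2] (mod 5) then 1 else 0) - (if [d = 3] (mod 5) then 1 else 0))"
      by cases (simp_all add: cong_def)
    ultimately show ?thesis by simp
  qed
  have "divisor_coeff 0 x N - divisor_coeff 0 (1 / x) N = (\<Sum>d | d dvd N. x ^ d - (1 / x) ^ d)"
    by (simp add: divisor_coeff_def sum_subtractf)
  also have "\<dots> = (x - x ^ 4) * (of_nat (dcount5 1 N) - of_nat (dcount5 4 N))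
      + (x ^ 2 - x ^ 3) * (of_nat (dcount5 2 N) - of_nat (dcount5 3 N))"
    unfolding pointwise cnt sum.distrib sum_subtractf sum_distrib_left[symmetric] ..
  finally show ?thesis by simp
qed

lemma lam1_ser_fifth_root:
  assumes q: "norm q < 1" and x: "x ^ 5 = 1"
  shows "lam1_ser 0 q x - lam1_ser 0 q (1 / x) = (x - x ^ 4) * S14 q + (x ^ 2 - x ^ 3) * S23 q"
proof -
  have nx: "norm x = 1"
    using x by (metis norm_one norm_power norm_ge_zero power_eq_1_iff zero_neq_numeral)
  then have nx': "norm (1 / x) = 1" by (simp add: norm_divide)
  have summ: "summable (\<lambda>N. divisor_coeff 0 y N * q ^ N)" if "norm y = 1" for y
  proof (rule summable_comparison_test')
    show "summable (\<lambda>N. real N ^ Suc 0 * norm q ^ N)"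
      using q by (intro summable_power_times_geometric) simp
    show "norm (divisor_coeff 0 y N * q ^ N) \<le> real N ^ Suc 0 * norm q ^ N" for N
      unfolding norm_mult norm_power by (intro mult_right_mono norm_divisor_coeff_le that) auto
  qed
  define u v where "u = x - x ^ 4" and "v = x ^ 2 - x ^ 3"
  have "(\<lambda>N. divisor_coeff 0 x N * q ^ N - divisor_coeff 0 (1 / x) N * q ^ N) sums
      (lam1_ser 0 q x - lam1_ser 0 q (1 / x))"
    unfolding lam1_ser_powser(1)[OF q nx] lam1_ser_powser(1)[OF q nx']
    by (intro sums_diff summable_sums summ nx nx')
  then have "(\<lambda>N. (divisor_coeff 0 x (Suc N) - divisor_coeff 0 (1 / x) (Suc N)) * q ^ Suc N) sums
      (lam1_ser 0 q x - lam1_ser 0 q (1 / x))"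
    unfolding left_diff_distrib by (subst sums_Suc_iff) simp
  moreover have "(\<lambda>N. u * (of_int (int (dcount5 1 (Suc N)) - int (dcount5 4 (Suc N))) * q ^ Suc N)
      + v * (of_int (int (dcount5 2 (Suc N)) - int (dcount5 3 (Suc N))) * q ^ Suc N)) sums
      (u * S14 q + v * S23 q)"
    unfolding S14_def S23_def
    by (intro sums_add sums_mult summable_sums summable_dcount5_diff q)
  moreover have "(divisor_coeff 0 x (Suc N) - divisor_coeff 0 (1 / x) (Suc N)) * q ^ Suc N =
      u * (of_int (int (dcount5 1 (Suc N)) - int (dcount5 4 (Suc N))) * q ^ Suc N)
      + v * (of_int (int (dcount5 2 (Suc N)) - int (dcount5 3 (Suc N))) * q ^ Suc N)" for N
    unfolding divisor_coeff_fifth_root[OF x zero_less_Suc] u_def v_def by (simp only: distrib_right mult.assoc)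
  ultimately show ?thesis
    unfolding u_def v_def by (simp only: sums_iff)
qed

text \<open>Halving the angle gives
  \<open>1 - cis t = - 2 * \<i> * sin (t / 2) * cis (t / 2)\<close>. This yields the cotangents in
  \<open>P5\<close> and \<open>Q5\<close>.\<close>

lemma cot_half_eq_cis:
  assumes "sin (t / 2) \<noteq> 0"
  shows "1 / (1 - cis t) - 1 / 2 = \<i> / 2 * of_real (cot (t / 2))"
proof -
  define s c where "s = complex_of_real (sin (t / 2))" and "c = complex_of_real (cos (t / 2))"
  have s0: "s \<noteq> 0" using assms by (simp add: s_def)
  have sc: "s ^ 2 + c ^ 2 = 1"
    unfolding s_def c_def by (metis of_real_1 of_real_add of_real_power sin_cos_squared_add)
  have "cis t = cis (t / 2) * cis (t / 2)" by (simp add: cis_mult)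
  also have "cis (t / 2) = c + \<i> * s"
    by (simp add: s_def c_def complex_eq_iff)
  finally have "1 - cis t = (s ^ 2 + c ^ 2) - (c + \<i> * s) * (c + \<i> * s)" using sc by simp
  also have "\<dots> = - (2 * \<i> * s * (c + \<i> * s))"
    by (simp add: power2_eq_square algebra_simps)
  finally have *: "1 - cis t = - (2 * \<i> * s * (c + \<i> * s))" .
  have "(c + \<i> * s) * (c - \<i> * s) = 1"
    using sc by (simp add: power2_eq_square algebra_simps)
  then have "1 / (c + \<i> * s) = c - \<i> * s"
    by (metis divide_eq_eq mult.commute mult_eq_0_iff zero_neq_one)
  moreover have "1 / - (2 * \<i> * s * w) = \<i> / (2 * s) * (1 / w)" for w
    using s0 by (simp add: divide_simps)
  ultimately have "1 / (1 - cis t) = \<i> / (2 * s) * (c - \<i> * s)"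
    unfolding * by (simp only:)
  also have "\<dots> = \<i> / 2 * (c / s) + 1 / 2"
    using s0 by (simp add: field_simps)
  finally show ?thesis
    by (simp add: cot_def s_def c_def)
qed

lemma cis_fifth: "cis (2 * pi / 5) ^ 5 = 1"
  by (simp add: Complex.DeMoivre)

lemma sin_fifths:
  "sin (6 * pi / 5) = - sin (4 * pi / 5)" "sin (8 * pi / 5) = - sin (2 * pi / 5)"
proof -
  have "sin (6 * pi / 5) = sin (2 * pi - 4 * pi / 5)" "sin (8 * pi / 5) = sin (2 * pi - 2 * pi / 5)"
    by (simp_all add: field_simps)
  then show "sin (6 * pi / 5) = - sin (4 * pi / 5)" "sin (8 * pi / 5) = - sin (2 * pi / 5)"
    by (simp_all only: sin_2pi_minus)
qed

lemma cos_fifths: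
  "cos (6 * pi / 5) = cos (4 * pi / 5)" "cos (8 * pi / 5) = cos (2 * pi / 5)"
proof -
  have "cos (6 * pi / 5) = cos (2 * pi - 4 * pi / 5)" "cos (8 * pi / 5) = cos (2 * pi - 2 * pi / 5)"
    by (simp_all add: field_simps)
  then show "cos (6 * pi / 5) = cos (4 * pi / 5)" "cos (8 * pi / 5) = cos (2 * pi / 5)"
    by (simp_all only: cos_2pi_minus)
qed

text \<open>Replacing \<open>z\<close> by \<open>z ^ 2\<close> turns the pair
  \<open>(z - z ^ 4, z ^ 2 - z ^ 3)\<close> into \<open>(z ^ 2 - z ^ 3, z ^ 4 - z)\<close>; this
  exchange with one sign is the difference between \<open>Q5\<close> and \<open>P5\<close>.\<close>

lemma P5_Q5_eq_kfun0:
  assumes q: "norm q < 1"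
  defines "z \<equiv> cis (2 * pi / 5)"
  shows "Q5 q = - 2 * \<i> * kfun0 q z" "P5 q = - 2 * \<i> * kfun0 q (z ^ 2)"
proof -
  have z5: "z ^ 5 = 1" unfolding z_def by (rule cis_fifth)
  then have z25: "(z ^ 2) ^ 5 = 1" by (metis power_commutes power_mult power_one mult.commute)
  have pow: "z ^ n = cis (2 * n * pi / 5)" for n :: nat
    by (simp add: z_def Complex.DeMoivre mult_ac)
  have d14: "z - z ^ 4 = 2 * \<i> * of_real (sin (2 * pi / 5))"
    unfolding pow[of 4] by (simp add: z_def complex_eq_iff sin_fifths cos_fifths)
  have d23: "z ^ 2 - z ^ 3 = 2 * \<i> * of_real (sin (4 * pi / 5))"
    unfolding pow by (simp add: complex_eq_iff sin_fifths cos_fifths)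
  have p8: "(z ^ 2) ^ 4 = z ^ 3" "(z ^ 2) ^ 2 = z ^ 4" "(z ^ 2) ^ 3 = z"
    using z5 by (simp_all add: power_numeral_reduce flip: power_mult)
  have s: "sin (2 * pi / 5 / 2) \<noteq> 0" "sin (4 * pi / 5 / 2) \<noteq> 0"
    using sin_gt_zero[of "2 * pi / 5 / 2"] sin_gt_zero[of "4 * pi / 5 / 2"] by (simp_all add: field_simps)
  have split_kfun0: "kfun0 q x = (1 / (1 - x) - 1 / 2) + (lam1_ser 0 q x - lam1_ser 0 q (1 / x))" for x
    by (simp add: kfun0_def)
  have "kfun0 q z = \<i> / 2 * of_real (cot (2 * pi / 5 / 2)) + ((z - z ^ 4) * S14 q + (z ^ 2 - z ^ 3) * S23 q)"
    unfolding split_kfun0 by (simp only: cot_half_eq_cis[OF s(1), folded z_def] lam1_ser_fifth_root[OF q z5])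
  then show "Q5 q = - 2 * \<i> * kfun0 q z"
    unfolding d14 d23 Q5_def by (simp add: algebra_simps)
  have "z ^ 2 = cis (4 * pi / 5)" using pow[of 2] by simp
  from cot_half_eq_cis[OF s(2), folded this]
  have kf: "kfun0 q (z ^ 2) = \<i> / 2 * of_real (cot (4 * pi / 5 / 2)) + ((z ^ 2 - z ^ 3) * S14 q + (z ^ 4 - z) * S23 q)"
    unfolding split_kfun0 lam1_ser_fifth_root[OF q z25] p8 by (simp only:)
  have d41: "z ^ 4 - z = - (2 * \<i> * of_real (sin (2 * pi / 5)))"
    using d14 by (simp add: algebra_simps)
  show "P5 q = - 2 * \<i> * kfun0 q (z ^ 2)"
    unfolding kf d41 d23 P5_def by (simp add: algebra_simps)
qed

section \<open>Algebraic relations at the fifth roots of unity\<close>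

lemma fifth_root_powers_neq_1:
  fixes z :: complex
  assumes "z ^ 5 = 1" "z \<noteq> 1"
  shows "z ^ 2 \<noteq> 1" "z ^ 3 \<noteq> 1" "z ^ 4 \<noteq> 1" "z ^ 3 = 1 / z ^ 2" "z ^ 4 = 1 / z"
proof -
  have z0: "z \<noteq> 0" using assms by auto
  have 5: "z * z ^ 4 = 1" "z ^ 2 * z ^ 3 = 1" "z * (z ^ 2) ^ 2 = 1"
    using assms(1) by (simp_all add: eval_nat_numeral mult_ac)
  show "z ^ 4 \<noteq> 1" using 5(1) assms(2) by auto
  show n2: "z ^ 2 \<noteq> 1"
  proof
    assume "z ^ 2 = 1"
    with 5(3) have "z = 1" by (simp only: power_one mult_1_right)
    with assms(2) show False ..
  qed
  show "z ^ 3 \<noteq> 1"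
  proof
    assume "z ^ 3 = 1"
    with 5(2) have "z ^ 2 = 1" by (simp only: mult_1_right)
    with n2 show False ..
  qed
  show "z ^ 3 = 1 / z ^ 2" "z ^ 4 = 1 / z"
    using 5(1,2) z0 by (simp_all add: field_simps)
qed

text \<open>The powers of \<open>z\<close> other than \<open>1\<close> form two inverse pairs, so by
  parity finitely many instances of the square and addition formulas close up on the values at
  \<open>z\<close> and \<open>z ^ 2\<close>.\<close>

lemma kfun_fifth_root_relations:
  assumes q: "norm q < 1" and z: "z ^ 5 = 1" "z \<noteq> 1"
  defines "a \<equiv> kfun0 q z" and "b \<equiv> kfun0 q (z ^ 2)" and "u \<equiv> kfun1 q z" and "v \<equiv> kfun1 q (z ^ 2)"
  shows "(2 * a - b) ^ 2 = 2 * u + v + E2 q / 4" "(a + 2 * b) ^ 2 = u + 2 * v + E2 q / 4"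
    and "2 * eser 1 q z = (3 * a + b) * (u - v) - 2 * a * u"
    and "2 * eser 1 q (z ^ 2) = (a - 3 * b) * (u - v) - 2 * b * v"
    and "eser 2 q z = (3 * a + b) * (u - v) * (a - b) - u ^ 2"
    and "eser 2 q (z ^ 2) = (a - 3 * b) * (u - v) * (a + b) - v ^ 2"
proof -
  note pw = fifth_root_powers_neq_1[OF z]
  have z0: "z \<noteq> 0" using z by auto
  have nz: "norm z = 1"
    using z by (metis norm_one norm_power norm_ge_zero power_eq_1_iff zero_neq_numeral)
  have nz': "norm (z ^ n) = 1" for n using nz by (simp add: norm_power)
  have prods: "z * z = z ^ 2" "z * z ^ 2 = z ^ 3" "z * z ^ 3 = z ^ 4" "z ^ 2 * z ^ 2 = z ^ 4"
    by (simp_all add: eval_nat_numeral)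
  have k3: "kfun0 q (z ^ 3) = - b" "kfun1 q (z ^ 3) = v" "eser j q (z ^ 3) = (-1) ^ j * eser j q (z ^ 2)" for j
    unfolding pw(4) b_def v_def using pw z0 q nz'
    by (auto intro!: kfun0_inverse kfun1_inverse eser_inverse)
  have k4: "kfun0 q (z ^ 4) = - a" "kfun1 q (z ^ 4) = u" "eser j q (z ^ 4) = (-1) ^ j * eser j q z" for j
    unfolding pw(5) a_def u_def using z z0 q nz
    by (auto intro!: kfun0_inverse kfun1_inverse eser_inverse)
  have E: "eser 0 q 1 = (1 - E2 q) / 12" using E2_eq_eser[OF q] by simp
  define s t where "s = eser 0 q z" and "t = eser 0 q (z ^ 2)"
  define s1 t1 where "s1 = eser 1 q z" and "t1 = eser 1 q (z ^ 2)"
  note folds = a_def[symmetric] b_def[symmetric] u_def[symmetric] v_def[symmetric]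
    s_def[symmetric] t_def[symmetric] s1_def[symmetric] t1_def[symmetric]
  have A1: "a ^ 2 = u - 2 * s + (1 / 4 - (1 - E2 q) / 12)"
    using kfun_square[OF q nz z(2)] unfolding folds E .
  have A2: "b ^ 2 = v - 2 * t + (1 / 4 - (1 - E2 q) / 12)"
    using kfun_square[OF q nz' pw(1)] unfolding folds E .
  \<comment> \<open>The pairs \<open>(z, z)\<close> and \<open>(z ^ 2, z ^ 2)\<close> have products
    \<open>z ^ 2\<close> and \<open>z ^ 4 = 1 / z\<close>. Together with \<open>A1\<close> and
    \<open>A2\<close> this eliminates \<open>s\<close> and \<open>t\<close>.\<close>
  have B1: "a * a - b * (a + a) = - 1 / 4 + t + s + s"
    using kfun_addition(1)[OF q nz z(2) nz z(2)] pw unfolding prods folds by blast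
  have B2: "b * b - (- a) * (b + b) = - 1 / 4 + s + t + t"
    using kfun_addition(1)[OF q nz' pw(1) nz' pw(1)] pw unfolding prods k4 folds by simp
  show R1: "(2 * a - b) ^ 2 = 2 * u + v + E2 q / 4"
    using A1 A2 B1 by (simp add: power2_eq_square field_simps) algebra
  show R2: "(a + 2 * b) ^ 2 = u + 2 * v + E2 q / 4"
    using A1 A2 B2 by (simp add: power2_eq_square field_simps) algebra
  \<comment> \<open>The pairs \<open>(z, z ^ 2)\<close> and \<open>(z, z ^ 3)\<close> give the
    difference and, since \<open>\<theta>e\<close> is odd under inversion, the sum of
    \<open>s1\<close> and \<open>t1\<close>.\<close>
  have C1: "u * b - a * v - (- b) * (u - v) = s1 - t1"
    using kfun_addition(2)[OF q nz z(2) nz' pw(1)] pw unfolding prods k3 folds by blast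
  have C2: "u * (- b) - a * v - (- a) * (u - v) = s1 - (-1) ^ 1 * t1"
    using kfun_addition(2)[OF q nz z(2) nz' pw(2)] pw unfolding prods k3 k4 folds by blast
  show D1: "2 * eser 1 q z = (3 * a + b) * (u - v) - 2 * a * u"
    unfolding folds using C1 C2 by (simp add: algebra_simps)
  show D2: "2 * eser 1 q (z ^ 2) = (a - 3 * b) * (u - v) - 2 * b * v"
    unfolding folds using C1 C2 by (simp add: algebra_simps)
  \<comment> \<open>In \<open>kfun2\<close> the terms \<open>2 * a * u\<close> and
    \<open>2 * b * v\<close> cancel against those in \<open>D1\<close> and
    \<open>D2\<close>.\<close>
  have w: "kfun2 q z = (3 * a + b) * (u - v)" "kfun2 q (z ^ 2) = (a - 3 * b) * (u - v)"
    using D1 D2 unfolding kfun2_def folds by simp_all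
  have "(3 * a + b) * (u - v) * a - 2 * u * u + a * ((3 * a + b) * (u - v))
     - b * ((3 * a + b) * (u - v) + (3 * a + b) * (u - v)) = eser 2 q z + eser 2 q z"
    using kfun_addition(3)[OF q nz z(2) nz z(2)] pw unfolding prods w folds by blast
  then show "eser 2 q z = (3 * a + b) * (u - v) * (a - b) - u ^ 2"
    by (simp add: power2_eq_square) algebra
  have "(a - 3 * b) * (u - v) * b - 2 * v * v + b * ((a - 3 * b) * (u - v))
     - (- a) * ((a - 3 * b) * (u - v) + (a - 3 * b) * (u - v)) = eser 2 q (z ^ 2) + eser 2 q (z ^ 2)"
    using kfun_addition(3)[OF q nz' pw(1) nz' pw(1)] pw unfolding prods k4 w folds by blast
  then show "eser 2 q (z ^ 2) = (a - 3 * b) * (u - v) * (a + b) - v ^ 2"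
    by (simp add: power2_eq_square) algebra
qed

text \<open>The first two hypotheses are linear in \<open>u\<close> and \<open>v\<close>; solving
  them leaves polynomial identities in \<open>a\<close>, \<open>b\<close> and \<open>R\<close>. The
  left-hand side of the third conclusion is \<open>q d/dq\<close> of
  \<open>4 * ((2 * a - b) ^ 2 - 2 * u - v)\<close>, which is \<open>R\<close>.\<close>

lemma ramanujan_system_algebra:
  fixes a b u v R e1 f1 e2 f2 :: complex
  assumes "(2 * a - b) ^ 2 = 2 * u + v + R / 4" "(a + 2 * b) ^ 2 = u + 2 * v + R / 4"
    and "2 * e1 = (3 * a + b) * (u - v) - 2 * a * u"
    and "2 * f1 = (a - 3 * b) * (u - v) - 2 * b * v"
    and "e2 = (3 * a + b) * (u - v) * (a - b) - u ^ 2"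
    and "f2 = (a - 3 * b) * (u - v) * (a + b) - v ^ 2"
  defines "P \<equiv> - 2 * \<i> * b" and "Q \<equiv> - 2 * \<i> * a"
  shows "- 2 * \<i> * f1 = (- 13 * P ^ 3 - 39 * P ^ 2 * Q + 47 * P * Q ^ 2 - 9 * Q ^ 3 + 2 * P * R) / 24"
    and "- 2 * \<i> * e1 = (9 * P ^ 3 + 47 * P ^ 2 * Q + 39 * P * Q ^ 2 - 13 * Q ^ 3 + 2 * Q * R) / 24"
    and "4 * (2 * (2 * a - b) * (2 * e1 - f1) - (2 * e2 + f2))
      = (5 * P ^ 4 - 15 * P ^ 3 * Q - 155 * P ^ 2 * Q ^ 2 + 15 * P * Q ^ 3 + 5 * Q ^ 4 + R ^ 2) / 12"
proof -
  have u: "u = (2 * (2 * a - b) ^ 2 - (a + 2 * b) ^ 2 - R / 4) / 3"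
    and v: "v = (2 * (a + 2 * b) ^ 2 - (2 * a - b) ^ 2 - R / 4) / 3"
    unfolding assms(1,2) by (simp_all add: field_simps)
  have e1: "e1 = ((3 * a + b) * (u - v) - 2 * a * u) / 2" and f1: "f1 = ((a - 3 * b) * (u - v) - 2 * b * v) / 2"
    unfolding assms(3,4)[symmetric] by simp_all
  have i: "\<i> ^ 3 = - \<i>" "\<i> ^ 4 = 1" by (simp_all add: eval_nat_numeral)
  have P: "P ^ 2 = - 4 * b ^ 2" "P ^ 3 = \<i> * (8 * b ^ 3)" "P ^ 4 = 16 * b ^ 4"
    and Q: "Q ^ 2 = - 4 * a ^ 2" "Q ^ 3 = \<i> * (8 * a ^ 3)" "Q ^ 4 = 16 * a ^ 4"
    using i by (simp_all add: P_def Q_def power_mult_distrib)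
  show "- 2 * \<i> * f1 = (- 13 * P ^ 3 - 39 * P ^ 2 * Q + 47 * P * Q ^ 2 - 9 * Q ^ 3 + 2 * P * R) / 24"
    unfolding P Q unfolding P_def Q_def f1 u v
    by (simp add: field_simps eval_nat_numeral)
  show "- 2 * \<i> * e1 = (9 * P ^ 3 + 47 * P ^ 2 * Q + 39 * P * Q ^ 2 - 13 * Q ^ 3 + 2 * Q * R) / 24"
    unfolding P Q unfolding P_def Q_def e1 u v
    by (simp add: field_simps eval_nat_numeral)
  show "4 * (2 * (2 * a - b) * (2 * e1 - f1) - (2 * e2 + f2))
      = (5 * P ^ 4 - 15 * P ^ 3 * Q - 155 * P ^ 2 * Q ^ 2 + 15 * P * Q ^ 3 + 5 * Q ^ 4 + R ^ 2) / 12"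
    unfolding P Q unfolding P_def Q_def assms(5,6) e1 f1 u v
    by (simp add: field_simps eval_nat_numeral)
qed

theorem theorem1p1:
  fixes q :: complex
  assumes "norm q < 1"
  shows "q * deriv P5 q =
           (- 13 * P5 q ^ 3 - 39 * P5 q ^ 2 * Q5 q + 47 * P5 q * Q5 q ^ 2 - 9 * Q5 q ^ 3
              + 2 * P5 q * E2 q) / 24
       \<and> q * deriv Q5 q =
           (9 * P5 q ^ 3 + 47 * P5 q ^ 2 * Q5 q + 39 * P5 q * Q5 q ^ 2 - 13 * Q5 q ^ 3
              + 2 * Q5 q * E2 q) / 24
       \<and> q * deriv E2 q =
           (5 * P5 q ^ 4 - 15 * P5 q ^ 3 * Q5 q - 155 * P5 q ^ 2 * Q5 q ^ 2
              + 15 * P5 q * Q5 q ^ 3 + 5 * Q5 q ^ 4 + E2 q ^ 2) / 12"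
proof -
  define z where "z = cis (2 * pi / 5)"
  have z5: "z ^ 5 = 1" unfolding z_def by (rule cis_fifth)
  have "sin (2 * pi / 5) > 0" by (rule sin_gt_zero) (simp_all add: field_simps)
  then have z1: "z \<noteq> 1" by (auto simp: z_def complex_eq_iff)
  have nz: "norm z = 1" "norm (z ^ 2) = 1" by (simp_all add: z_def norm_power)
  define w where "w = z ^ 2"
  define a b u v where "a = (\<lambda>q. kfun0 q z)" and "b = (\<lambda>q. kfun0 q w)"
    and "u = (\<lambda>q. kfun1 q z)" and "v = (\<lambda>q. kfun1 q w)"
  note defs = a_def b_def u_def v_def
  obtain Da Db Du Dv where D: "(a has_field_derivative Da) (at q)" "(b has_field_derivative Db) (at q)"
      "(u has_field_derivative Du) (at q)" "(v has_field_derivative Dv) (at q)"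
    and D': "q * Da = eser 1 q z" "q * Db = eser 1 q w" "q * Du = eser 2 q z" "q * Dv = eser 2 q w"
    using kfun_deriv[OF assms nz(1)] kfun_deriv[OF assms nz(2)] unfolding defs w_def by metis
  note rel = kfun_fifth_root_relations[OF _ z5 z1, folded w_def]
  \<comment> \<open>Valid on the whole open disc, these formulas transfer the derivatives of
    \<open>a\<close>, \<open>b\<close>, \<open>u\<close>, \<open>v\<close> to \<open>P5\<close>,
    \<open>Q5\<close> and \<open>E2\<close>.\<close>
  have PQ: "P5 x = - 2 * \<i> * b x" "Q5 x = - 2 * \<i> * a x"
    and E: "E2 x = 4 * ((2 * a x - b x) ^ 2 - (2 * u x + v x))" if "norm x < 1" for x
    using P5_Q5_eq_kfun0[OF that] rel(1)[OF that] unfolding defs w_def z_def by simp_all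
  have dP: "(P5 has_field_derivative - 2 * \<i> * Db) (at q)"
    by (rule has_field_derivative_transform_within_open[OF DERIV_cmult[OF D(2)], where S = "ball 0 1"])
       (use assms in \<open>auto simp: PQ\<close>)
  have dQ: "(Q5 has_field_derivative - 2 * \<i> * Da) (at q)"
    by (rule has_field_derivative_transform_within_open[OF DERIV_cmult[OF D(1)], where S = "ball 0 1"])
       (use assms in \<open>auto simp: PQ\<close>)
  have dE: "(E2 has_field_derivative 4 * (2 * (2 * a q - b q) * (2 * Da - Db) - (2 * Du + Dv))) (at q)"
  proof (rule has_field_derivative_transform_within_open[where S = "ball 0 1"])
    show "((\<lambda>x. 4 * ((2 * a x - b x) ^ 2 - (2 * u x + v x))) has_field_derivative
        4 * (2 * (2 * a q - b q) * (2 * Da - Db) - (2 * Du + Dv))) (at q)"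
      by (rule derivative_eq_intros D refl)+ (simp add: algebra_simps)
  qed (use assms in \<open>auto simp: E\<close>)
  have "kfun0 q z = a q" "kfun0 q w = b q" by (simp_all only: defs)
  note fin = ramanujan_system_algebra[OF rel[OF assms], unfolded this, folded PQ[OF assms]]
  have "q * (- 2 * \<i> * Db) = - 2 * \<i> * eser 1 q w" "q * (- 2 * \<i> * Da) = - 2 * \<i> * eser 1 q z"
    unfolding D'[symmetric] by (simp_all add: mult_ac)
  moreover have "q * (4 * (2 * (2 * a q - b q) * (2 * Da - Db) - (2 * Du + Dv)))
     = 4 * (2 * (2 * a q - b q) * (2 * eser 1 q z - eser 1 q w) - (2 * eser 2 q z + eser 2 q w))"
    unfolding D'[symmetric] by (simp add: algebra_simps)
  ultimately show ?thesis
    unfolding DERIV_imp_deriv[OF dP] DERIV_imp_deriv[OF dQ] DERIV_imp_deriv[OF dE]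
    by (simp only: fin)
qed

end
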